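(* There is a polynomial-time many-one reduction from Homogeneous Quadratic Sphere Feasibility (HQSF) to Tensor Spectral Threshold (for symmetric order-$4$ tensors).
   Context: HQSF: given symmetric matrices $Q_1,\dots,Q_r\in\mathbb{Q}^{m\times m}$, decide whether there exists $z\in\mathbb{R}^m$ with $\|z\|^2=1$ and $z^\top Q_i z=0$ for all $i=1,\dots,r$ ($\|\cdot\|$ the Euclidean norm). For a symmetric tensor $\mathcal{T}\in\mathrm{Sym}^d(\mathbb{R}^n)$ (entries invariant under permutation of indices), $\|\mathcal{T}\|_{\mathrm{sym},\mathrm{op}}:=\max_{\|x\|=1}|\mathcal{T}(x,\dots,x)|$ where $\mathcal{T}(x,\dots,x)=\sum_{i_1,\dots,i_d}\mathcal{T}_{i_1\dots i_d}x_{i_1}\cdots x_{i_d}$. Tensor Spectral Threshold: given a symmetric tensor with rational entries and $\alpha\in\mathbb{Q}$, decide whether $\|\mathcal{T}\|_{\mathrm{sym},\mathrm{op}}\ge\alpha$. A polynomial-time many-one reduction maps instances in polynomial time preserving YES/NO answers. *)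

theory Defs
  imports
    Complex_Main
    "HOL-Library.Multiset"
    "HOL-Library.FuncSet"
    "HOL-Computational_Algebra.Polynomial"
    "Jordan_Normal_Form.Matrix"
begin

section \<open>Deterministic multi-tape Turing machines\<close>

datatype dir = MoveL | Stay | MoveR

text \<open>
  A tape is infinite in both directions, \<open>None\<close> is the blank, and cells are numbered relative to
  the head: the head always scans cell \<open>0\<close>, and a head movement shifts the contents.
\<close>

type_synonym 'a tape = "int \<Rightarrow> 'a option"

definition word_tape :: "'a list \<Rightarrow> 'a tape" where
  "word_tape w = (\<lambda>i. if 0 \<le> i \<and> i < int (length w) then Some (w ! nat i) else None)"

fun offset :: "dir \<Rightarrow> int" where
  "offset MoveL = -1"
| "offset Stay = 0"
| "offset MoveR = 1"

definition act :: "'a option \<times> dir \<Rightarrow> 'a tape \<Rightarrow> 'a tape" where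
  "act = (\<lambda>(a, d) t. (\<lambda>i. (t(0 := a)) (i + offset d)))"

record 'a tm =
  ntapes :: nat
  states :: "nat set"
  start :: nat
  halt :: nat
  delta :: "nat \<Rightarrow> 'a option list \<Rightarrow> nat \<times> ('a option \<times> dir) list"

text \<open>
  The alphabet is a finite type, so the conditions below make the relevant part of the transition
  function a finite table.
\<close>

definition wf_tm :: "('a::finite) tm \<Rightarrow> bool" where
  "wf_tm M \<longleftrightarrow>
     ntapes M \<ge> 1 \<and> finite (states M) \<and> start M \<in> states M \<and> halt M \<in> states M \<and>
     (\<forall>q \<in> states M. \<forall>as. length as = ntapes M \<longrightarrow>
        fst (delta M q as) \<in> states M \<and> length (snd (delta M q as)) = ntapes M)"

type_synonym 'a config = "nat \<times> 'a tape list"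

definition initial_config :: "'a tm \<Rightarrow> 'a list \<Rightarrow> 'a config" where
  "initial_config M w = (start M, word_tape w # replicate (ntapes M - 1) (word_tape []))"

definition step :: "'a tm \<Rightarrow> 'a config \<Rightarrow> 'a config" where
  "step M = (\<lambda>(q, ts).
     if q = halt M then (q, ts)
     else let (q', as) = delta M q (map (\<lambda>t. t 0) ts) in (q', map2 act as ts))"

definition computes_within :: "'a tm \<Rightarrow> nat \<Rightarrow> 'a list \<Rightarrow> 'a list \<Rightarrow> bool" where
  "computes_within M t x y \<longleftrightarrow>
     (let (q, ts) = (step M ^^ t) (initial_config M x) in q = halt M \<and> hd ts = word_tape y)"


section \<open>Decision problems and polynomial-time many-one reductions\<close>

record ('i, 'a) problem =
  instances :: "'i set"
  yes :: "'i \<Rightarrow> bool"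
  encode :: "'i \<Rightarrow> 'a list"

definition poly_time_map ::
    "('i, 'a::finite) problem \<Rightarrow> ('j, 'a) problem \<Rightarrow> ('i \<Rightarrow> 'j) \<Rightarrow> bool" where
  "poly_time_map A B f \<longleftrightarrow>
     (\<exists>(M :: 'a tm) (p :: nat poly). wf_tm M \<and>
        (\<forall>x \<in> instances A.
           computes_within M (poly p (length (encode A x))) (encode A x) (encode B (f x))))"

definition many_one_reduction ::
    "('i, 'a) problem \<Rightarrow> ('j, 'a) problem \<Rightarrow> ('i \<Rightarrow> 'j) \<Rightarrow> bool" where
  "many_one_reduction A B f \<longleftrightarrow>
     f \<in> instances A \<rightarrow> instances B \<and> (\<forall>x \<in> instances A. yes A x \<longleftrightarrow> yes B (f x))"

definition poly_time_many_one_reducible ::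
    "('i, 'a::finite) problem \<Rightarrow> ('j, 'a) problem \<Rightarrow> bool" where
  "poly_time_many_one_reducible A B \<longleftrightarrow>
     (\<exists>f. many_one_reduction A B f \<and> poly_time_map A B f)"


section \<open>Binary encoding of numbers\<close>

datatype letter = Zero | One | Sep

instance letter :: finite
proof
  have "(UNIV :: letter set) = {Zero, One, Sep}"
    using letter.exhaust by blast
  then show "finite (UNIV :: letter set)"
    by (metis finite.emptyI finite_insert)
qed

text \<open>Least significant bit first, without superfluous zeros.\<close>

fun bits :: "nat \<Rightarrow> letter list" where
  "bits n = (if n = 0 then [] else (if even n then Zero else One) # bits (n div 2))"

declare bits.simps [simp del]

definition enc_int :: "int \<Rightarrow> letter list" where
  "enc_int k = (if k < 0 then One else Zero) # bits (nat \<bar>k\<bar>) @ [Sep]"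

text \<open>Numerator and denominator in lowest terms, as returned by \<^const>\<open>quotient_of\<close>.\<close>

definition enc_rat :: "rat \<Rightarrow> letter list" where
  "enc_rat r = enc_int (fst (quotient_of r)) @ enc_int (snd (quotient_of r))"

definition enc_dim :: "nat \<Rightarrow> letter list" where
  "enc_dim n = replicate n One @ [Sep]"


section \<open>Homogeneous quadratic sphere feasibility\<close>

definition vnorm :: "real vec \<Rightarrow> real" where
  "vnorm x = sqrt (x \<bullet> x)"

definition HQSF :: "(nat \<times> rat mat list, letter) problem" where
  "HQSF = \<lparr>
     instances = {(m, Qs). m \<ge> 1 \<and> (\<forall>Q \<in> set Qs. Q \<in> carrier_mat m m \<and> transpose_mat Q = Q)},
     yes = (\<lambda>(m, Qs). \<exists>z \<in> carrier_vec m. (vnorm z)\<^sup>2 = 1 \<and>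
              (\<forall>Q \<in> set Qs. z \<bullet> (map_mat of_rat Q *\<^sub>v z) = 0)),
     encode = (\<lambda>(m, Qs). enc_dim m @
        concat (map (\<lambda>Q. concat [enc_rat (Q $$ (i, j)). i \<leftarrow> [0..<m], j \<leftarrow> [0..<m]]) Qs))
   \<rparr>"


section \<open>Symmetric tensors and the spectral threshold problem\<close>

text \<open>
  A tensor of order \<open>d\<close> over an \<open>n\<close>-dimensional space is a function on the lists of \<open>d\<close> indices
  below \<open>n\<close>; its values on other lists play no role.
\<close>

definition indices :: "nat \<Rightarrow> nat \<Rightarrow> nat list set" where
  "indices d n = {is. length is = d \<and> set is \<subseteq> {..<n}}"

definition symmetric_tensor :: "nat \<Rightarrow> nat \<Rightarrow> (nat list \<Rightarrow> 'b) \<Rightarrow> bool" where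
  "symmetric_tensor d n T \<longleftrightarrow>
     (\<forall>is \<in> indices d n. \<forall>js \<in> indices d n. mset is = mset js \<longrightarrow> T is = T js)"

definition tensor_form :: "nat \<Rightarrow> nat \<Rightarrow> (nat list \<Rightarrow> real) \<Rightarrow> real vec \<Rightarrow> real" where
  "tensor_form d n T x = (\<Sum>is \<in> indices d n. T is * (\<Prod>i\<leftarrow>is. x $ i))"

text \<open>For \<open>n \<ge> 1\<close> the sphere is compact and nonempty, so this supremum is a maximum.\<close>

definition sym_op_norm :: "nat \<Rightarrow> nat \<Rightarrow> (nat list \<Rightarrow> real) \<Rightarrow> real" where
  "sym_op_norm d n T = (SUP x \<in> {x \<in> carrier_vec n. vnorm x = 1}. \<bar>tensor_form d n T x\<bar>)"

definition tensor_spectral_threshold ::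
    "nat \<Rightarrow> (nat \<times> (nat list \<Rightarrow> rat) \<times> rat, letter) problem" where
  "tensor_spectral_threshold d = \<lparr>
     instances = {(n, T, \<alpha>). n \<ge> 1 \<and> symmetric_tensor d n T},
     yes = (\<lambda>(n, T, \<alpha>). sym_op_norm d n (\<lambda>is. of_rat (T is)) \<ge> of_rat \<alpha>),
     encode = (\<lambda>(n, T, \<alpha>). enc_dim n @
        concat (map (\<lambda>is. enc_rat (T is)) (List.n_lists d [0..<n])) @ enc_rat \<alpha>)
   \<rparr>"

end

theory Submission
  imports Defs "HOL-Library.Countable" "HOL-Analysis.Function_Topology"
begin

text \<open>
  Let \<open>D\<close> be the product of all denominators, \<open>E\<^sub>k = D Q\<^sub>k\<close>, \<open>q\<^sub>k(x) = x\<^sup>T E\<^sub>k x\<close>, and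
  \<open>K = 2 ^ (8 L)\<close> with \<open>L\<close> the length of the instance. Symmetrising
  \<open>K |x|\<^sup>4 - \<Sum>\<^sub>k q\<^sub>k(x)\<^sup>2\<close> and multiplying by 3 gives an integral tensor. As \<open>\<Sum>\<^sub>k q\<^sub>k\<^sup>2 \<le> K\<close> on the
  sphere, the absolute value of its form there is \<open>3 K - 3 \<Sum>\<^sub>k q\<^sub>k\<^sup>2\<close>, so by compactness its norm is at
  least \<open>3 K\<close> iff the \<open>q\<^sub>k\<close> have a common zero. Clearing denominators avoids any reduction of
  fractions to lowest terms.

  For the running time, a tape whose head scans the first letter of a word is treated as a stack, so a
  multi-tape machine is a program over stacks. Coding pairs and lists into words, the functions
  computed by such programs in polynomial time are closed under composition, pairing, case
  distinction and folds whose accumulator stays polynomially small; the reduction is then written as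
  a functional program with binary arithmetic on lists of bits.
\<close>

section \<open>Stack programs and their Turing machines\<close>

text \<open>A norm threshold detects large values of a form, while HQSF asks for common zeros.
  Subtracting squares from a constant turns zeros into maxima; a dominating constant keeps the form
  nonnegative on the sphere, so that the absolute value creates no false maxima. The constant only
  has to be an upper bound that can be written down from the input length alone, hence a power of
  two: the cleared entries, their number and the dimension are all at most \<open>2 ^ L\<close>,
  which leads to \<open>2 ^ (7 * L)\<close>. The factor 3 counts the ways to split four tensor
  positions into two pairs; the symmetrisation of a square averages over them.

  The obstacle on the complexity side is iteration: a polynomial-time loop body that doubles its
  accumulator already gives exponential size. Size growth is therefore a side condition of the fold
  rules, and the arithmetic is arranged to satisfy it. Running times are proved for all words,
  correctness only for encodings of instances.\<close>

instance letter :: countable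
  by countable_datatype

datatype cmd =
    Push nat letter
  | Put nat letter
  | Pop nat
  | Seq cmd cmd
  | If_top nat "letter list" cmd cmd
  | While_top nat "letter list" cmd

text \<open>Control states are lists of commands, but machine states are natural numbers;
  countability supplies the injection \<open>to_nat\<close>.\<close>

instance cmd :: countable
  by countable_datatype

type_synonym store = "nat \<Rightarrow> letter list"

definition top_in :: "letter list \<Rightarrow> letter list \<Rightarrow> bool" where
  "top_in w A \<longleftrightarrow> w \<noteq> [] \<and> hd w \<in> set A"

text \<open>The time is the exact number of machine steps: \<open>Push\<close> takes two, the move
  and the write, and each unfolding of a compound command takes one. \<open>Put\<close> has no rule
  because it arises only as the second half of a \<open>Push\<close>.\<close>

inductive exec :: "cmd \<Rightarrow> store \<Rightarrow> nat \<Rightarrow> store \<Rightarrow> bool" where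
  Push: "exec (Push i a) s 2 (s(i := a # s i))"
| Pop: "exec (Pop i) s 1 (s(i := tl (s i)))"
| Seq: "exec c s t s' \<Longrightarrow> exec d s' t' s'' \<Longrightarrow> exec (Seq c d) s (Suc (t + t')) s''"
| If_True: "top_in (s i) A \<Longrightarrow> exec c s t s' \<Longrightarrow> exec (If_top i A c d) s (Suc t) s'"
| If_False: "\<not> top_in (s i) A \<Longrightarrow> exec d s t s' \<Longrightarrow> exec (If_top i A c d) s (Suc t) s'"
| While_False: "\<not> top_in (s i) A \<Longrightarrow> exec (While_top i A c) s 1 s"
| While_True: "top_in (s i) A \<Longrightarrow> exec c s t s' \<Longrightarrow> exec (While_top i A c) s' t' s''
    \<Longrightarrow> exec (While_top i A c) s (Suc (t + t')) s''"

primrec regs :: "cmd \<Rightarrow> nat set" where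
  "regs (Push i a) = {i}"
| "regs (Put i a) = {i}"
| "regs (Pop i) = {i}"
| "regs (Seq c d) = regs c \<union> regs d"
| "regs (If_top i A c d) = insert i (regs c \<union> regs d)"
| "regs (While_top i A c) = insert i (regs c)"

lemma finite_regs: "finite (regs c)"
  by (induction c) auto

text \<open>
  The control state of the machine is the list of commands that remain to be executed. A tape whose
  head scans the first letter of a word is a stack: pushing takes a move to the left, for which the
  auxiliary command \<^const>\<open>Put\<close> is left behind, and then a write.
\<close>

fun next_control :: "cmd list \<Rightarrow> (nat \<Rightarrow> letter option) \<Rightarrow> cmd list" where
  "next_control [] r = []"
| "next_control (Push i a # ks) r = Put i a # ks"
| "next_control (Put i a # ks) r = ks"
| "next_control (Pop i # ks) r = ks"
| "next_control (Seq c d # ks) r = c # d # ks"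
| "next_control (If_top i A c d # ks) r = (if r i \<in> Some ` set A then c else d) # ks"
| "next_control (While_top i A c # ks) r =
     (if r i \<in> Some ` set A then c # While_top i A c # ks else ks)"

fun next_action :: "cmd list \<Rightarrow> (nat \<Rightarrow> letter option) \<Rightarrow> nat \<Rightarrow> letter option \<times> dir" where
  "next_action (Push i a # ks) r j = (r j, if j = i then MoveL else Stay)"
| "next_action (Put i a # ks) r j = (if j = i then Some a else r j, Stay)"
| "next_action (Pop i # ks) r j = (if j = i then (None, MoveR) else (r j, Stay))"
| "next_action ks r j = (r j, Stay)"

text \<open>The control lists that can occur while \<open>c\<close> runs in front of the
  continuation \<open>ks\<close>, before \<open>ks\<close> is reached. The set stays finite because
  a loop is the continuation of its own body, so unrolling creates no new lists.\<close>

primrec controls :: "cmd \<Rightarrow> cmd list \<Rightarrow> cmd list set" where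
  "controls (Push i a) ks = {Push i a # ks, Put i a # ks}"
| "controls (Put i a) ks = {Put i a # ks}"
| "controls (Pop i) ks = {Pop i # ks}"
| "controls (Seq c d) ks = insert (Seq c d # ks) (controls c (d # ks) \<union> controls d ks)"
| "controls (If_top i A c d) ks = insert (If_top i A c d # ks) (controls c ks \<union> controls d ks)"
| "controls (While_top i A c) ks = insert (While_top i A c # ks) (controls c (While_top i A c # ks))"

lemma finite_controls: "finite (controls c ks)"
  by (induction c arbitrary: ks) auto

lemma Cons_in_controls: "c # ks \<in> controls c ks"
  by (cases c) auto

text \<open>The only exit from the set is \<open>ks\<close>. For \<open>ks = []\<close> this is the
  halting state, so the state set of \<open>machine\<close> is closed under its transitions.\<close>

lemma next_control_closed:
  "l \<in> controls c ks \<Longrightarrow> next_control l r \<in> insert ks (controls c ks)"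
proof (induction c arbitrary: ks)
  case (Seq c d)
  then show ?case using Cons_in_controls[of c "d # ks"] Cons_in_controls[of d ks] by fastforce
next
  case (If_top i A c d)
  then show ?case using Cons_in_controls[of c ks] Cons_in_controls[of d ks] by auto
next
  case (While_top i A c)
  then show ?case using Cons_in_controls[of c "While_top i A c # ks"] by fastforce
qed auto

definition machine :: "cmd \<Rightarrow> nat \<Rightarrow> letter tm" where
  "machine c N = \<lparr> ntapes = N, states = to_nat ` insert [] (controls c []),
     start = to_nat [c], halt = to_nat ([] :: cmd list),
     delta = (\<lambda>q as. let l = from_nat q; r = (\<lambda>i. as ! i) in
       (to_nat (next_control l r), map (next_action l r) [0..<N])) \<rparr>"

lemma wf_machine: "N \<ge> 1 \<Longrightarrow> wf_tm (machine c N)"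
  using next_control_closed[of _ c "[]"] Cons_in_controls[of c "[]"]
  by (auto simp: wf_tm_def machine_def Let_def finite_controls)

definition tapes :: "nat \<Rightarrow> store \<Rightarrow> letter tape list" where
  "tapes N s = map (\<lambda>i. word_tape (s i)) [0..<N]"

text \<open>Stated for arbitrary tapes \<open>T\<close> instead of stores: halfway through a
  \<open>Push\<close>, the tape that has moved left is in general not the tape of a word.\<close>

lemma step_machine:
  assumes "l \<noteq> []"
  shows "step (machine c N) (to_nat l, map T [0..<N]) =
    (to_nat (next_control l (\<lambda>i. map (\<lambda>t. t 0) (map T [0..<N]) ! i)),
     map (\<lambda>i. act (next_action l (\<lambda>i. map (\<lambda>t. t 0) (map T [0..<N]) ! i) i) (T i)) [0..<N])"
proof -
  have *: "map2 f (map g xs) (map h xs) = map (\<lambda>i. f (g i) (h i)) xs"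
    for f :: "letter option \<times> dir \<Rightarrow> letter tape \<Rightarrow> letter tape" and g h and xs :: "nat list"
    by (induction xs) auto
  show ?thesis
    using assms by (simp add: step_def machine_def Let_def * del: map_map)
qed

lemma act_keep: "act (t 0, Stay) t = t"
  by (auto simp: act_def fun_eq_iff)

lemma act_Pop: "act (None, MoveR) (word_tape w) = word_tape (tl w)"
  by (cases w) (auto simp: act_def word_tape_def fun_eq_iff nth_Cons' nat_diff_distrib nat_add_distrib)

lemma act_Push: "act (Some a, Stay) (act (word_tape w 0, MoveL) (word_tape w)) = word_tape (a # w)"
  by (auto simp: act_def word_tape_def fun_eq_iff nth_Cons' nat_diff_distrib)

lemma word_tape_top: "word_tape w 0 \<in> Some ` set A \<longleftrightarrow> top_in w A"
  by (cases w) (auto simp: word_tape_def top_in_def)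

lemma funpow_Suc_add_apply: "(f ^^ Suc (m + n)) x = (f ^^ n) ((f ^^ m) (f x))"
  by (metis add.commute add_Suc comp_apply funpow_Suc_right funpow_add)

text \<open>The continuation \<open>ks\<close> is arbitrary so that the induction hypotheses for the
  parts of a command apply with the remaining commands behind them. The program \<open>c0\<close>
  may differ from \<open>c\<close> because a transition depends only on the decoded control
  list.\<close>

lemma exec_machine:
  assumes "exec c s t s'" and "regs c \<subseteq> {..<N}"
  shows "(step (machine c0 N) ^^ t) (to_nat (c # ks), tapes N s) = (to_nat ks, tapes N s')"
  using assms
proof (induction arbitrary: ks)
  case (Push i a s)
  let ?T = "\<lambda>j. if j = i then act (word_tape (s i) 0, MoveL) (word_tape (s i)) else word_tape (s j)"
  have "step (machine c0 N) (to_nat (Push i a # ks), tapes N s) =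
      (to_nat (Put i a # ks), map ?T [0..<N])"
    unfolding tapes_def by (subst step_machine) (auto simp: act_keep)
  moreover have "step (machine c0 N) (to_nat (Put i a # ks), map ?T [0..<N]) =
      (to_nat ks, tapes N (s(i := a # s i)))"
    by (subst step_machine) (auto simp: act_keep tapes_def act_Push)
  ultimately show ?case
    by (simp add: numeral_2_eq_2 fun_upd_def)
next
  case (Pop i s)
  then show ?case
    by (auto simp: tapes_def step_machine act_keep act_Pop)
next
  case (Seq c s t s' d t' s'')
  have "step (machine c0 N) (to_nat (Seq c d # ks), tapes N s) = (to_nat (c # d # ks), tapes N s)"
    unfolding tapes_def by (subst step_machine) (auto simp: act_keep)
  with Seq show ?case
    by (simp only: funpow_Suc_add_apply) simp
next
  case (If_True s i A c t s' d)
  have "step (machine c0 N) (to_nat (If_top i A c d # ks), tapes N s) = (to_nat (c # ks), tapes N s)"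
    using If_True unfolding tapes_def
    by (subst step_machine) (auto simp: act_keep word_tape_top)
  with If_True show ?case
    by (simp add: funpow_swap1)
next
  case (If_False s i A d t s' c)
  have "step (machine c0 N) (to_nat (If_top i A c d # ks), tapes N s) = (to_nat (d # ks), tapes N s)"
    using If_False unfolding tapes_def
    by (subst step_machine) (auto simp: act_keep word_tape_top)
  with If_False show ?case
    by (simp add: funpow_swap1)
next
  case (While_False s i A c)
  then show ?case
    unfolding tapes_def using step_machine[of "While_top i A c # ks"]
    by (auto simp: act_keep word_tape_top)
next
  case (While_True s i A c t s' t' s'')
  have "step (machine c0 N) (to_nat (While_top i A c # ks), tapes N s) =
      (to_nat (c # While_top i A c # ks), tapes N s)"
    using While_True unfolding tapes_def
    by (subst step_machine) (auto simp: act_keep word_tape_top)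
  with While_True show ?case
    by (simp only: funpow_Suc_add_apply) simp
qed

section \<open>Runs with time bounds\<close>

definition single :: "letter list \<Rightarrow> store" where
  "single w = (\<lambda>_. [])(0 := w)"

definition exec_within :: "cmd \<Rightarrow> store \<Rightarrow> nat \<Rightarrow> store \<Rightarrow> bool" where
  "exec_within c s T s' \<longleftrightarrow> (\<exists>t \<le> T. exec c s t s')"

lemma step_halt: "step M (halt M, ts) = (halt M, ts)"
  by (simp add: step_def)

text \<open>\<open>computes_within\<close> inspects the configuration after exactly \<open>T\<close>
  steps. A halted configuration is a fixed point of \<open>step\<close>, so a shorter run can be
  padded.\<close>

lemma computes_within_machine:
  assumes "exec_within c (single x) T (single y)" and "regs c \<subseteq> {..<N}" "N \<ge> 1"
  shows "computes_within (machine c N) T x y"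
proof -
  let ?M = "machine c N"
  obtain t where t: "t \<le> T" "exec c (single x) t (single y)"
    using assms(1) by (auto simp: exec_within_def)
  have halt: "(step ?M ^^ n) (to_nat ([] :: cmd list), ts) = (to_nat ([] :: cmd list), ts)" for n ts
    using step_halt[of ?M ts] by (induction n) (auto simp: machine_def)
  have tapes: "tapes N (single w) = word_tape w # replicate (N - 1) (word_tape [])" for w
    using \<open>N \<ge> 1\<close> by (auto simp: tapes_def single_def nth_Cons' intro!: nth_equalityI)
  have "initial_config ?M x = (to_nat [c], tapes N (single x))"
    unfolding tapes by (simp add: initial_config_def machine_def)
  moreover have "(step ?M ^^ T) (to_nat [c], tapes N (single x)) = (to_nat ([] :: cmd list), tapes N (single y))"
  proof -
    have "(step ?M ^^ T) u = (step ?M ^^ (T - t)) ((step ?M ^^ t) u)" for u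
      using t(1) funpow_add[of "T - t" t "step ?M"] by simp
    then show ?thesis
      by (simp only: exec_machine[OF t(2) assms(2), of c "[]"] halt)
  qed
  moreover have "hd (tapes N (single y)) = word_tape y"
    unfolding tapes by simp
  ultimately show ?thesis
    by (simp add: computes_within_def machine_def)
qed

lemma exec_within_mono: "exec_within c s T s' \<Longrightarrow> s' = s'' \<Longrightarrow> T \<le> T' \<Longrightarrow> exec_within c s T' s''"
  by (auto simp: exec_within_def intro: order_trans)

lemma exec_within_Push: "exec_within (Push i a) s 2 (s(i := a # s i))"
  and exec_within_Pop: "exec_within (Pop i) s 1 (s(i := tl (s i)))"
  using exec.Push exec.Pop by (auto simp: exec_within_def simp del: One_nat_def)

lemma exec_within_Seq:
  assumes "exec_within c s T s'" and "exec_within d s' T' s''"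
  shows "exec_within (Seq c d) s (Suc (T + T')) s''"
proof -
  obtain t t' where "t \<le> T" "exec c s t s'" "t' \<le> T'" "exec d s' t' s''"
    using assms by (auto simp: exec_within_def)
  then show ?thesis
    unfolding exec_within_def by (intro exI[of _ "Suc (t + t')"]) (auto intro: exec.Seq)
qed

lemma exec_within_If:
  assumes "top_in (s i) A \<Longrightarrow> exec_within c s T s'" and "\<not> top_in (s i) A \<Longrightarrow> exec_within d s T s'"
  shows "exec_within (If_top i A c d) s (Suc T) s'"
  using assms unfolding exec_within_def
  by (cases "top_in (s i) A") (metis Suc_le_mono exec.If_True, metis Suc_le_mono exec.If_False)

lemma exec_within_While_False: "\<not> top_in (s i) A \<Longrightarrow> exec_within (While_top i A c) s 1 s"
  using exec.While_False by (auto simp: exec_within_def simp del: One_nat_def)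

lemma exec_within_While_True:
  assumes "top_in (s i) A" and "exec_within c s T s'" and "exec_within (While_top i A c) s' T' s''"
  shows "exec_within (While_top i A c) s (Suc (T + T')) s''"
proof -
  obtain t t' where "t \<le> T" "exec c s t s'" "t' \<le> T'" "exec (While_top i A c) s' t' s''"
    using assms by (auto simp: exec_within_def)
  then show ?thesis
    unfolding exec_within_def using assms(1)
    by (intro exI[of _ "Suc (t + t')"]) (auto intro: exec.While_True)
qed

text \<open>One step adds at most one letter to a stack. Every time bound thus yields a bound on the
  size of the output, which is what composition needs.\<close>

lemma exec_length: "exec c s t s' \<Longrightarrow> length (s' i) \<le> length (s i) + t"
  by (induction rule: exec.induct) auto

lemma exec_within_length: "exec_within c s T s' \<Longrightarrow> length (s' i) \<le> length (s i) + T"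
  unfolding exec_within_def using exec_length[of c s _ s' i] by fastforce

primrec shift :: "nat \<Rightarrow> cmd \<Rightarrow> cmd" where
  "shift k (Push i a) = Push (i + k) a"
| "shift k (Put i a) = Put (i + k) a"
| "shift k (Pop i) = Pop (i + k)"
| "shift k (Seq c d) = Seq (shift k c) (shift k d)"
| "shift k (If_top i A c d) = If_top (i + k) A (shift k c) (shift k d)"
| "shift k (While_top i A c) = While_top (i + k) A (shift k c)"

lemma exec_shift:
  assumes "exec c s t s'"
  shows "exec (shift k c) (\<lambda>j. if j < k then S j else s (j - k)) t
    (\<lambda>j. if j < k then S j else s' (j - k))"
  using assms
proof (induction rule: exec.induct)
  case (Push i a s)
  have "(\<lambda>j. if j < k then S j else (s(i := a # s i)) (j - k)) =
    (\<lambda>j. if j < k then S j else s (j - k))(i + k := a # (\<lambda>j. if j < k then S j else s (j - k)) (i + k))"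
    by (auto simp: fun_eq_iff)
  then show ?case using exec.Push[of "i + k" a "\<lambda>j. if j < k then S j else s (j - k)"]
    by (simp del: fun_upd_apply)
next
  case (Pop i s)
  have "(\<lambda>j. if j < k then S j else (s(i := tl (s i))) (j - k)) =
    (\<lambda>j. if j < k then S j else s (j - k))(i + k := tl ((\<lambda>j. if j < k then S j else s (j - k)) (i + k)))"
    by (auto simp: fun_eq_iff)
  then show ?case using exec.Pop[of "i + k" "\<lambda>j. if j < k then S j else s (j - k)"]
    by (simp del: fun_upd_apply One_nat_def)
next
  case Seq
  then show ?case using exec.Seq by simp
next
  case If_True
  then show ?case by (auto intro: exec.If_True)
next
  case If_False
  then show ?case by (auto intro: exec.If_False)
next
  case While_False
  then show ?case by (auto intro: exec.While_False simp del: One_nat_def)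
next
  case While_True
  then show ?case by (auto intro: exec.While_True)
qed

text \<open>A subroutine call. Stacks below \<open>k\<close> are preserved, but those above
  \<open>k\<close> must be empty because the program expects \<open>single w\<close>; callers
  therefore place the argument on the highest stack in use.\<close>

lemma exec_within_shift:
  assumes "exec_within c (single w) T (single v)" and "S k = w" and "\<And>j. j > k \<Longrightarrow> S j = []"
  shows "exec_within (shift k c) S T (S(k := v))"
proof -
  have *: "(\<lambda>j. if j < k then S j else single u (j - k)) = S(k := u)" for u
    using assms(3) by (auto simp: fun_eq_iff single_def)
  obtain t where "t \<le> T" "exec c (single w) t (single v)"
    using assms(1) by (auto simp: exec_within_def)
  then show ?thesis
    using exec_shift[of c "single w" t "single v" k S] assms(2)
    unfolding * by (auto simp: exec_within_def)
qed

section \<open>Basic stack routines\<close>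

definition skip :: cmd where
  "skip = While_top 0 [] (Pop 0)"

lemma exec_within_skip: "exec_within skip s 1 s"
  unfolding skip_def by (rule exec_within_While_False) (simp add: top_in_def)

primrec push_all :: "nat \<Rightarrow> letter list \<Rightarrow> cmd" where
  "push_all j [] = skip"
| "push_all j (a # xs) = Seq (push_all j xs) (Push j a)"

lemma exec_within_push_all: "exec_within (push_all j xs) s (3 * length xs + 1) (s(j := xs @ s j))"
proof (induction xs)
  case Nil
  then show ?case using exec_within_skip by simp
next
  case (Cons a xs)
  show ?case
    by (rule exec_within_mono, unfold push_all.simps, rule exec_within_Seq[OF Cons exec_within_Push[of j a]]) auto
qed

text \<open>The popped letter is remembered in the control state, by branching to a separate copy of
  the code for each letter.\<close>

definition dispatch :: "nat \<Rightarrow> (letter \<Rightarrow> cmd) \<Rightarrow> cmd" where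
  "dispatch i B = If_top i [Zero] (Seq (Pop i) (B Zero))
     (If_top i [One] (Seq (Pop i) (B One)) (Seq (Pop i) (B Sep)))"

lemma exec_within_dispatch:
  assumes "exec_within (B a) (s(i := w)) T s'" and "s i = a # w"
  shows "exec_within (dispatch i B) s (T + 4) s'"
proof -
  have "exec_within (Seq (Pop i) (B a)) s (T + 2) s'"
    using exec_within_Seq[OF exec_within_Pop[of i s], of "B a" T s'] assms by simp
  then have *: "exec_within (Seq (Pop i) (B a)) s (T + 2) s'" "exec_within (Seq (Pop i) (B a)) s (Suc (T + 2)) s'"
    by (auto intro: exec_within_mono[OF _ refl])
  have "exec_within (dispatch i B) s (Suc (Suc (T + 2))) s'"
    unfolding dispatch_def using assms(2) *
    by (intro exec_within_If; cases a) (auto simp: top_in_def)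
  then show ?thesis by (simp add: numeral_eq_Suc)
qed

abbreviation "letters \<equiv> [Zero, One, Sep]"

lemma top_in_letters: "top_in w letters \<longleftrightarrow> w \<noteq> []"
  by (metis (full_types) letter.exhaust list.set_intros(1,2) top_in_def)

definition pass :: "nat \<Rightarrow> nat \<Rightarrow> (letter \<Rightarrow> letter list) \<Rightarrow> nat \<Rightarrow> (letter \<Rightarrow> letter list) \<Rightarrow> cmd" where
  "pass i j g k h = While_top i letters (dispatch i (\<lambda>a. Seq (push_all j (g a)) (push_all k (h a))))"

text \<open>Words of at most three letters cost at most 10 steps to push, so an iteration takes at
  most \<open>10 + 10 + 1\<close> for the pushes, 4 for \<open>dispatch\<close> and 1 for the loop;
  30 is rounded up. The input is consumed from the top, hence the reversal.\<close>

lemma exec_within_pass: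
  assumes "\<And>a. length (g a) \<le> 3" "\<And>a. length (h a) \<le> 3" and "i \<noteq> j" "i \<noteq> k" "j \<noteq> k"
  shows "exec_within (pass i j g k h) s (30 * length (s i) + 1)
    (s(i := [], j := concat (map g (rev (s i))) @ s j, k := concat (map h (rev (s i))) @ s k))"
proof (induction "s i" arbitrary: s)
  case Nil
  then show ?case
    unfolding pass_def
    by (intro exec_within_mono[OF exec_within_While_False[of s i letters]]) (auto simp: top_in_def fun_eq_iff)
next
  case (Cons a w)
  let ?s1 = "(s(i := w))(j := g a @ s j)"
  let ?s2 = "?s1(k := h a @ s k)"
  have "exec_within (Seq (push_all j (g a)) (push_all k (h a))) (s(i := w)) 21 ?s2"
    using assms(1)[of a] assms(2)[of a] assms(3-)
    by (intro exec_within_mono[OF exec_within_Seq[OF exec_within_push_all[of j "g a" "s(i := w)"]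
          exec_within_push_all[of k "h a"]]]) auto
  from exec_within_dispatch[where B = "\<lambda>a. Seq (push_all j (g a)) (push_all k (h a))", OF this]
  have 1: "exec_within (dispatch i (\<lambda>a. Seq (push_all j (g a)) (push_all k (h a)))) s 25 ?s2"
    using Cons(2) by simp
  have w: "?s2 i = w" using assms by auto
  show ?case
    unfolding pass_def
    apply (rule exec_within_mono)
      apply (rule exec_within_While_True[OF _ 1 Cons(1)[of ?s2, OF w[symmetric], unfolded pass_def]])
      apply (use Cons(2) in \<open>simp add: top_in_letters flip: Cons(2)\<close>)
     apply (use Cons(2) assms in \<open>simp add: fun_eq_iff w flip: Cons(2)\<close>)
    apply (use Cons(2) w in \<open>simp flip: Cons(2)\<close>)
    done
qed

text \<open>\<open>Suc (i + j)\<close> only has to be a stack different from both \<open>i\<close>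
  and \<open>j\<close>; nothing is written to it.\<close>

definition reverse_onto :: "nat \<Rightarrow> nat \<Rightarrow> cmd" where
  "reverse_onto i j = pass i j (\<lambda>a. [a]) (Suc (i + j)) (\<lambda>_. [])"

lemma exec_within_reverse_onto:
  "i \<noteq> j \<Longrightarrow> exec_within (reverse_onto i j) s (30 * length (s i) + 1) (s(i := [], j := rev (s i) @ s j))"
  unfolding reverse_onto_def
  by (rule exec_within_mono[OF exec_within_pass[of "\<lambda>a. [a]" "\<lambda>_. []" i j "Suc (i + j)" s]])
    (auto simp: fun_eq_iff)

definition clear :: "nat \<Rightarrow> cmd" where
  "clear i = pass i (i + 1) (\<lambda>_. []) (i + 2) (\<lambda>_. [])"

lemma exec_within_clear: "exec_within (clear i) s (30 * length (s i) + 1) (s(i := []))"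
  unfolding clear_def
  by (rule exec_within_mono[OF exec_within_pass[of "\<lambda>_. []" "\<lambda>_. []" i "i + 1" "i + 2" s]])
    (auto simp: fun_eq_iff)

text \<open>A self-delimiting code: \<open>code u @ [Zero]\<close> is never a proper prefix of another such word.\<close>

definition code :: "letter list \<Rightarrow> letter list" where
  "code u = concat (map (\<lambda>a. [One, a]) u)"

lemma code_simps [simp]: "code [] = []" "code (a # u) = One # a # code u"
  by (auto simp: code_def)

lemma length_code [simp]: "length (code u) = 2 * length u"
  by (induction u) auto

definition take_block :: "nat \<Rightarrow> nat \<Rightarrow> (letter \<Rightarrow> letter list) \<Rightarrow> cmd" where
  "take_block i j g =
     Seq (While_top i [One] (Seq (Pop i) (dispatch i (\<lambda>a. push_all j (g a))))) (Pop i)"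

text \<open>In a code, \<open>One\<close> announces a further letter and \<open>Zero\<close> ends
  the block, so the top of the stack alone controls the loop.\<close>

lemma exec_within_take_block:
  assumes "\<And>a. length (g a) \<le> 3" and "i \<noteq> j" and "s i = code u @ Zero # v"
  shows "exec_within (take_block i j g) s (30 * length u + 3) (s(i := v, j := concat (map g (rev u)) @ s j))"
proof -
  let ?c = "While_top i [One] (Seq (Pop i) (dispatch i (\<lambda>a. push_all j (g a))))"
  have "exec_within ?c s (30 * length u + 1) (s(i := Zero # v, j := concat (map g (rev u)) @ s j))"
    using assms(3)
  proof (induction u arbitrary: s)
    case Nil
    then show ?case
      by (intro exec_within_mono[OF exec_within_While_False[of s i "[One]"]]) (auto simp: top_in_def fun_eq_iff)
  next
    case (Cons a u)
    let ?s2 = "(s(i := code u @ Zero # v))(j := g a @ s j)"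
    have "exec_within (push_all j (g a)) ((s(i := tl (s i)))(i := code u @ Zero # v)) 10 ?s2"
      using assms(1)[of a] assms(2)
      by (intro exec_within_mono[OF exec_within_push_all]) auto
    from exec_within_dispatch[where B = "\<lambda>a. push_all j (g a)", OF this]
    have 1: "exec_within (dispatch i (\<lambda>a. push_all j (g a))) (s(i := tl (s i))) 14 ?s2"
      using Cons(2) by simp
    have w: "?s2 i = code u @ Zero # v" using assms by auto
    have t: "top_in (s i) [One]" using Cons(2) by (simp add: top_in_def)
    show ?case
      using assms(2)
      by (intro exec_within_mono[OF exec_within_While_True[OF t exec_within_Seq[OF exec_within_Pop 1] Cons(1)[of ?s2, OF w]]])
        (auto simp: fun_eq_iff)
  qed
  from exec_within_mono[OF exec_within_Seq[OF this exec_within_Pop[of i]]] assms(2) show ?thesis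
    unfolding take_block_def by (auto simp: fun_eq_iff)
qed


section \<open>Polynomial-time functions on structured data\<close>

class repr =
  fixes rep :: "'a \<Rightarrow> letter list"

instantiation unit :: repr
begin
definition rep_unit :: "unit \<Rightarrow> letter list" where "rep_unit _ = []"
instance ..
end

instantiation bool :: repr
begin
definition rep_bool :: "bool \<Rightarrow> letter list" where "rep_bool b = [if b then One else Zero]"
instance ..
end

instantiation letter :: repr
begin
definition rep_letter :: "letter \<Rightarrow> letter list" where "rep_letter a = [a]"
instance ..
end

text \<open>Natural numbers are in unary; binary numbers will be lists of Booleans.\<close>

instantiation nat :: repr
begin
definition rep_nat :: "nat \<Rightarrow> letter list" where "rep_nat n = replicate n Zero"
instance ..
end

instantiation prod :: (repr, repr) repr
begin
definition rep_prod :: "'a \<times> 'b \<Rightarrow> letter list" where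
  "rep_prod p = code (rep (fst p)) @ Zero # rep (snd p)"
instance ..
end

instantiation list :: (repr) repr
begin
definition rep_list :: "'a list \<Rightarrow> letter list" where
  "rep_list xs = concat (map (\<lambda>x. code (rep x) @ [Zero]) xs)"
instance ..
end

abbreviation rsize :: "'a::repr \<Rightarrow> nat" where
  "rsize x \<equiv> length (rep x)"

text \<open>Nonempty lists share their representation with pairs, and unary numbers with lists of
  units, so passing between them costs no computation.\<close>

lemma rep_Nil [simp]: "rep [] = []"
  and rep_Cons: "rep (x # xs) = rep (x, xs)"
  and rep_nat_eq: "rep n = rep (replicate n ())"
  by (auto simp: rep_list_def rep_prod_def rep_nat_def rep_unit_def concat_replicate_single)

text \<open>Even an element with empty representation contributes its closing \<open>Zero\<close>;
  emptiness of a list can thus be tested at the top of the stack.\<close>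

lemma rep_eq_Nil_iff [simp]: "rep (xs :: 'a::repr list) = [] \<longleftrightarrow> xs = []"
  by (cases xs) (auto simp: rep_Cons rep_prod_def)

lemma rsize_simps [simp]:
  "rsize (u :: unit) = 0" "rsize (b :: bool) = 1" "rsize (a :: letter) = 1" "rsize (n :: nat) = n"
  "rsize (x, y) = 2 * rsize x + 1 + rsize y"
  "rsize (z # zs) = 2 * rsize z + 1 + rsize zs"
  by (auto simp: rep_unit_def rep_bool_def rep_letter_def rep_nat_def rep_prod_def rep_Cons)

lemma rsize_append [simp]: "rsize (xs @ ys) = rsize xs + rsize ys"
  by (induction xs) auto

lemma rsize_rev [simp]: "rsize (rev xs) = rsize xs"
  by (induction xs) auto

lemma rsize_mem: "x \<in> set xs \<Longrightarrow> rsize x \<le> rsize xs"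
  by (induction xs) auto

lemma length_le_rsize: "length xs \<le> rsize xs"
  by (induction xs) auto

section \<open>Basic closure properties of polynomial-time functions\<close>

text \<open>The coefficients are natural numbers. Monotonicity allows size bounds to be substituted
  into time bounds.\<close>

lemma poly_nat_mono: "x \<le> y \<Longrightarrow> poly p x \<le> poly p (y :: nat)"
  by (induction p) (auto intro!: add_mono mult_mono)

text \<open>All scratch stacks are empty before and after the run, so programs compose by
  \<open>Seq\<close>.\<close>

definition computes_fun :: "cmd \<Rightarrow> nat poly \<Rightarrow> ('a::repr \<Rightarrow> 'b::repr) \<Rightarrow> bool" where
  "computes_fun P p f \<longleftrightarrow> (\<forall>x. exec_within P (single (rep x)) (poly p (rsize x)) (single (rep (f x))))"

definition ptime :: "('a::repr \<Rightarrow> 'b::repr) \<Rightarrow> bool" where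
  "ptime f \<longleftrightarrow> (\<exists>P p. computes_fun P p f)"

lemma computes_funD:
  "computes_fun P p f \<Longrightarrow> exec_within P (single (rep x)) (poly p (rsize x)) (single (rep (f x)))"
  by (simp add: computes_fun_def)

lemma computes_fun_size: "computes_fun P p f \<Longrightarrow> rsize (f x) \<le> rsize x + poly p (rsize x)"
  using exec_within_length[OF computes_funD[of P p f x], of 0] by (simp add: single_def)

lemma ptimeE:
  assumes "ptime f"
  obtains P p where "computes_fun P p f"
  using assms by (auto simp: ptime_def)

lemma ptime_size:
  assumes "ptime f"
  obtains p where "\<And>x. rsize (f x) \<le> poly p (rsize x)"
proof -
  obtain P p where "computes_fun P p f" using assms by (rule ptimeE)
  then have "rsize (f x) \<le> poly ([:0, 1:] + p) (rsize x)" for x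
    using computes_fun_size[of P p f x] by simp
  then show ?thesis by (rule that)
qed

lemma ptimeI:
  assumes "\<And>x. exec_within P (single (rep x)) (poly p (rsize x)) (single (rep (f x)))"
  shows "ptime f"
  using assms unfolding ptime_def computes_fun_def by blast

lemma ptime_cast:
  assumes "ptime f" and "\<And>x. rep (g x) = rep (f x)"
  shows "ptime g"
  using assms by (auto simp: ptime_def computes_fun_def)

lemma ptime_id: "ptime (\<lambda>x. x)"
  by (rule ptimeI[of skip "[:1:]"]) (use exec_within_skip in simp)

lemma ptime_comp:
  assumes "ptime f" and "ptime g"
  shows "ptime (\<lambda>x. g (f x))"
proof -
  obtain P p Q q where P: "computes_fun P p f" and Q: "computes_fun Q q g"
    using assms by (meson ptimeE)
  have "exec_within (Seq P Q) (single (rep x))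
      (poly ([:1:] + p + pcompose q ([:0, 1:] + p)) (rsize x)) (single (rep (g (f x))))" for x
    using poly_nat_mono[OF computes_fun_size[OF P], of q x]
    by (intro exec_within_mono[OF exec_within_Seq[OF computes_funD[OF P] computes_funD[OF Q]]])
      (auto simp: poly_pcompose)
  then show ?thesis by (rule ptimeI)
qed

lemma ptime_const: "ptime (\<lambda>_. c)"
proof -
  have "exec_within (Seq (clear 0) (push_all 0 (rep c))) (single (rep x))
      (poly [:3 + 3 * rsize c, 30:] (rsize x)) (single (rep c))" for x :: 'a
    by (intro exec_within_mono[OF exec_within_Seq[OF exec_within_clear exec_within_push_all]])
      (auto simp: single_def fun_eq_iff)
  then show ?thesis by (rule ptimeI)
qed

definition dup :: cmd where
  "dup = Seq (reverse_onto 0 2) (pass 2 0 (\<lambda>a. [a]) 1 (\<lambda>a. [a]))"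

lemma concat_map_single [simp]: "concat (map (\<lambda>a. [a]) xs) = xs"
  by (induction xs) auto

lemma exec_within_dup:
  "exec_within dup (single w) (60 * length w + 3) ((single w)(1 := w))"
  unfolding dup_def
  by (intro exec_within_mono[OF exec_within_Seq[OF exec_within_reverse_onto exec_within_pass]])
    (auto simp: single_def fun_eq_iff)

lemma ptime_Pair:
  assumes "ptime f" and "ptime g"
  shows "ptime (\<lambda>x. (f x, g x))"
proof -
  obtain P p Q q where P: "computes_fun P p f" and Q: "computes_fun Q q g"
    using assms by (meson ptimeE)
  \<comment> \<open>With \<open>x\<close> on stacks 0 and 1, \<open>P\<close> turns stack 1 into
    \<open>f x\<close>. The other copy travels through stack 3 to stack 2, two reversals preserving
    its order, since \<open>Q\<close> must run above \<open>f x\<close>. Its result goes back to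
    stack 0, and \<open>f x\<close> is coded on top of it.\<close>
  let ?c = "Seq dup (Seq (shift 1 P) (Seq (reverse_onto 0 3) (Seq (reverse_onto 3 2) (Seq (shift 2 Q)
    (Seq (reverse_onto 2 3) (Seq (reverse_onto 3 0) (Seq (Push 0 Zero) (Seq (reverse_onto 1 2)
    (pass 2 0 (\<lambda>a. [One, a]) 1 (\<lambda>_. []))))))))))"
  have "exec_within ?c (single (rep x)) (poly ([:100, 500:] + [:200:] * (p + q)) (rsize x))
      (single (rep (f x, g x)))" for x
    using computes_fun_size[OF P, of x] computes_fun_size[OF Q, of x]
    by (intro exec_within_mono[OF exec_within_Seq[OF exec_within_dup
          exec_within_Seq[OF exec_within_shift[OF computes_funD[OF P, of x]]
          exec_within_Seq[OF exec_within_reverse_onto exec_within_Seq[OF exec_within_reverse_onto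
          exec_within_Seq[OF exec_within_shift[OF computes_funD[OF Q, of x]]
          exec_within_Seq[OF exec_within_reverse_onto exec_within_Seq[OF exec_within_reverse_onto
          exec_within_Seq[OF exec_within_Push exec_within_Seq[OF exec_within_reverse_onto
          exec_within_pass]]]]]]]]]])
      (auto simp: single_def fun_eq_iff rep_prod_def code_def)
  then show ?thesis by (rule ptimeI)
qed

lemma ptime_fst: "ptime f \<Longrightarrow> ptime (\<lambda>x. fst (f x))"
proof (erule ptime_comp)
  let ?c = "Seq (take_block 0 1 (\<lambda>a. [a])) (Seq (clear 0) (reverse_onto 1 0))"
  have "exec_within ?c (single (rep p)) (poly [:100, 100:] (rsize p)) (single (rep (fst p)))"
    for p :: "'b \<times> 'c"
    by (intro exec_within_mono[OF exec_within_Seq[OF exec_within_take_block[where u = "rep (fst p)" and v = "rep (snd p)"]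
          exec_within_Seq[OF exec_within_clear exec_within_reverse_onto]]])
      (auto simp: single_def fun_eq_iff rep_prod_def)
  then show "ptime (fst :: 'b \<times> 'c \<Rightarrow> 'b)" by (rule ptimeI)
qed

lemma ptime_snd: "ptime f \<Longrightarrow> ptime (\<lambda>x. snd (f x))"
proof (erule ptime_comp)
  have "exec_within (take_block 0 1 (\<lambda>a. [])) (single (rep p)) (poly [:100, 100:] (rsize p)) (single (rep (snd p)))"
    for p :: "'b \<times> 'c"
    by (intro exec_within_mono[OF exec_within_take_block[where u = "rep (fst p)" and v = "rep (snd p)"]])
      (auto simp: single_def fun_eq_iff rep_prod_def)
  then show "ptime (snd :: 'b \<times> 'c \<Rightarrow> 'c)" by (rule ptimeI)
qed

lemma ptime_If:
  assumes "ptime c" and "ptime f" and "ptime g"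
  shows "ptime (\<lambda>x. if c x then f x else g x)"
proof -
  obtain P p Q q R r where P: "computes_fun P p c" and Q: "computes_fun Q q f" and R: "computes_fun R r g"
    using assms by (meson ptimeE)
  let ?c = "Seq (Seq dup (shift 1 P)) (If_top 1 [One] (Seq (Pop 1) Q) (Seq (Pop 1) R))"
  have "exec_within ?c (single (rep x)) (poly ([:20, 60:] + p + q + r) (rsize x))
      (single (rep (if c x then f x else g x)))" for x
  proof -
    let ?s = "(single (rep x))(1 := rep (c x))"
    have *: "?s(1 := tl (?s 1)) = single (rep x)"
      by (auto simp: rep_bool_def single_def fun_eq_iff)
    have "exec_within (Seq (Pop 1) Q) ?s (poly ([:2:] + q + r) (rsize x)) (single (rep (f x)))"
      using exec_within_Pop[of 1 ?s] unfolding *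
      by (intro exec_within_mono[OF exec_within_Seq[OF _ computes_funD[OF Q]]]) auto
    moreover have "exec_within (Seq (Pop 1) R) ?s (poly ([:2:] + q + r) (rsize x)) (single (rep (g x)))"
      using exec_within_Pop[of 1 ?s] unfolding *
      by (intro exec_within_mono[OF exec_within_Seq[OF _ computes_funD[OF R]]]) auto
    moreover have "top_in (?s 1) [One] \<longleftrightarrow> c x"
      by (auto simp: top_in_def rep_bool_def)
    ultimately have 2: "exec_within (If_top 1 [One] (Seq (Pop 1) Q) (Seq (Pop 1) R)) ?s
        (Suc (poly ([:2:] + q + r) (rsize x))) (single (rep (if c x then f x else g x)))"
      by (intro exec_within_If) auto
    have 1: "exec_within (Seq dup (shift 1 P)) (single (rep x)) (60 * rsize x + 4 + poly p (rsize x)) ?s"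
      by (rule exec_within_mono[OF exec_within_Seq[OF exec_within_dup
              exec_within_shift[OF computes_funD[OF P, of x]]]])
        (auto simp: single_def)
    show ?thesis
      by (rule exec_within_mono[OF exec_within_Seq[OF 1 2]]) auto
  qed
  then show ?thesis by (rule ptimeI)
qed

lemma exec_within_If_bound:
  assumes "top_in (s i) A \<Longrightarrow> exec_within c s T s'" and "\<not> top_in (s i) A \<Longrightarrow> exec_within d s T s'"
    and "Suc T \<le> T'"
  shows "exec_within (If_top i A c d) s T' s'"
  using exec_within_mono[OF exec_within_If[OF assms(1,2)] refl assms(3)] .

lemma ptime_letter_in:
  fixes A :: "letter list"
  assumes "ptime f"
  shows "ptime (\<lambda>x. f x \<in> set A)"
proof (rule ptime_comp[OF assms])
  have "exec_within (If_top 0 A (Seq (Pop 0) (Push 0 One)) (Seq (Pop 0) (Push 0 Zero)))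
      (single (rep a)) (poly [:10:] (rsize a)) (single (rep (a \<in> set A)))" for a
  proof (rule exec_within_If_bound[where T = 5])
    show "exec_within (Seq (Pop 0) (Push 0 One)) (single (rep a)) 5 (single (rep (a \<in> set A)))"
      if "top_in (single (rep a) 0) A"
      by (rule exec_within_mono[OF exec_within_Seq[OF exec_within_Pop exec_within_Push]])
        (use that in \<open>auto simp: single_def fun_eq_iff top_in_def rep_bool_def rep_letter_def\<close>)
    show "exec_within (Seq (Pop 0) (Push 0 Zero)) (single (rep a)) 5 (single (rep (a \<in> set A)))"
      if "\<not> top_in (single (rep a) 0) A"
      by (rule exec_within_mono[OF exec_within_Seq[OF exec_within_Pop exec_within_Push]])
        (use that in \<open>auto simp: single_def fun_eq_iff top_in_def rep_bool_def rep_letter_def\<close>)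
  qed simp
  then show "ptime (\<lambda>a. a \<in> set A)" by (rule ptimeI)
qed

lemma ptime_letter_eq: "ptime f \<Longrightarrow> ptime (\<lambda>x. f x = (a :: letter))"
  using ptime_letter_in[of f "[a]"] by simp

lemma ptime_not_Nil:
  fixes f :: "'a::repr \<Rightarrow> 'b::repr list"
  assumes "ptime f"
  shows "ptime (\<lambda>x. f x \<noteq> [])"
proof (rule ptime_comp[OF assms])
  have "exec_within (If_top 0 letters (Seq (clear 0) (Push 0 One)) (Seq (clear 0) (Push 0 Zero)))
      (single (rep xs)) (poly [:10, 30:] (rsize xs)) (single (rep (xs \<noteq> [])))" for xs :: "'b list"
  proof (rule exec_within_If_bound[where T = "30 * rsize xs + 5"])
    show "exec_within (Seq (clear 0) (Push 0 One)) (single (rep xs)) (30 * rsize xs + 5) (single (rep (xs \<noteq> [])))"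
      if "top_in (single (rep xs) 0) letters"
      by (rule exec_within_mono[OF exec_within_Seq[OF exec_within_clear exec_within_Push]])
        (use that in \<open>auto simp: single_def fun_eq_iff top_in_letters rep_bool_def\<close>)
    show "exec_within (Seq (clear 0) (Push 0 Zero)) (single (rep xs)) (30 * rsize xs + 5) (single (rep (xs \<noteq> [])))"
      if "\<not> top_in (single (rep xs) 0) letters"
      by (rule exec_within_mono[OF exec_within_Seq[OF exec_within_clear exec_within_Push]])
        (use that in \<open>auto simp: single_def fun_eq_iff top_in_letters rep_bool_def\<close>)
  qed simp
  then show "ptime (\<lambda>xs :: 'b list. xs \<noteq> [])" by (rule ptimeI)
qed

definition uncons :: "'a \<times> 'a list \<Rightarrow> 'a list \<Rightarrow> 'a \<times> 'a list" where
  "uncons d xs = (if xs = [] then d else (hd xs, tl xs))"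

text \<open>A nonempty list already is the representation of its head and tail, so the program
  leaves it alone; only for the empty list it writes the default.\<close>

lemma ptime_uncons:
  fixes f :: "'a::repr \<Rightarrow> 'b::repr list"
  assumes "ptime f"
  shows "ptime (\<lambda>x. uncons d (f x))"
proof (rule ptime_comp[OF assms])
  have "exec_within (If_top 0 letters skip (push_all 0 (rep d)))
      (single (rep xs)) (poly [:10 + 3 * rsize d:] (rsize xs)) (single (rep (uncons d xs)))"
    for xs :: "'b list"
  proof (rule exec_within_If_bound[where T = "3 * rsize d + 5"])
    show "exec_within skip (single (rep xs)) (3 * rsize d + 5) (single (rep (uncons d xs)))"
      if "top_in (single (rep xs) 0) letters"
    proof (rule exec_within_mono[OF exec_within_skip])
      have "xs \<noteq> []" using that by (auto simp: single_def top_in_letters)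
      then show "single (rep xs) = single (rep (uncons d xs))"
        by (cases xs) (simp_all add: uncons_def rep_Cons)
    qed simp
    show "exec_within (push_all 0 (rep d)) (single (rep xs)) (3 * rsize d + 5) (single (rep (uncons d xs)))"
      if "\<not> top_in (single (rep xs) 0) letters"
      by (rule exec_within_mono[OF exec_within_push_all])
        (use that in \<open>auto simp: single_def fun_eq_iff top_in_letters uncons_def\<close>)
  qed simp
  then show "ptime (uncons d :: 'b list \<Rightarrow> _)" by (rule ptimeI)
qed

text \<open>
  The block that codes the head of a list also codes the first component of a pair. So moving it from
  the list on stack 0 onto the accumulator on stack 1 forms the argument of the loop body \<open>H\<close>.
\<close>

definition fold_cmd :: "cmd \<Rightarrow> cmd" where
  "fold_cmd H = While_top 0 letters
     (Seq (take_block 0 2 (\<lambda>a. [a, One])) (Seq (Push 1 Zero) (Seq (reverse_onto 2 1) (shift 1 H))))"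

text \<open>Moving a block reverses it. Storing each pair swapped, as \<open>[a, One]\<close>, makes
  the second reversal restore the code.\<close>

lemma rev_code: "rev (concat (map (\<lambda>a. [a, One]) (rev u))) = code u"
  and length_rev_code: "length (concat (map (\<lambda>a. [a, One]) (rev u))) = 2 * length u"
  by (induction u) auto

text \<open>\<open>B\<close> bounds the accumulator after every prefix of the list, and
  \<open>2 * N + B + 1\<close> the argument of the body. Each element occupies at least one letter,
  so \<open>rsize xs\<close> bounds the number of iterations.\<close>

lemma exec_within_fold_cmd:
  assumes H: "computes_fun H q (\<lambda>p. h (fst p) (snd p))"
    and B: "\<And>ys zs. xs = ys @ zs \<Longrightarrow> rsize (fold h ys s) \<le> B" and N: "rsize xs \<le> N"
  shows "exec_within (fold_cmd H) ((single (rep xs))(1 := rep s))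
    (rsize xs * (100 * (N + B + 1) + poly q (2 * N + B + 1)) + 1) ((single [])(1 := rep (fold h xs s)))"
  using B N
proof (induction xs arbitrary: s)
  case Nil
  show ?case
    unfolding fold_cmd_def
    by (rule exec_within_mono[OF exec_within_While_False]) (auto simp: single_def top_in_def)
next
  case (Cons x xs)
  have IH: "exec_within (fold_cmd H) ((single (rep xs))(1 := rep (h x s)))
    (rsize xs * (100 * (N + B + 1) + poly q (2 * N + B + 1)) + 1) ((single [])(1 := rep (fold h xs (h x s))))"
  proof (rule Cons.IH)
    show "rsize (fold h ys (h x s)) \<le> B" if "xs = ys @ zs" for ys zs
      using Cons.prems(1)[of "x # ys" zs] that by simp
  qed (use Cons.prems in simp)
  have s: "rsize s \<le> B" using Cons.prems(1)[of "[]" "x # xs"] by simp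
  have x: "rsize x \<le> N" using Cons.prems by simp
  have q: "poly q (rsize (x, s)) \<le> poly q (2 * N + B + 1)"
    by (rule poly_nat_mono) (use s x in simp)
  have *: "rev (concat (map (\<lambda>a. [a, One]) (rev (rep x)))) @ Zero # rep s = rep (x, s)"
    by (simp add: rev_code rep_prod_def)
  let ?s0 = "(single (rep (x # xs)))(1 := rep s)"
  \<comment> \<open>Using 99 instead of 100 leaves room for the step of the loop test.\<close>
  have 1: "exec_within (Seq (take_block 0 2 (\<lambda>a. [a, One])) (Seq (Push 1 Zero) (Seq (reverse_onto 2 1) (shift 1 H))))
    ?s0 (99 * (N + B + 1) + poly q (2 * N + B + 1)) ((single (rep xs))(1 := rep (h x s)))"
    using q s x
    by (intro exec_within_mono[OF exec_within_Seq[OF exec_within_take_block[where u = "rep x" and v = "rep xs"]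
          exec_within_Seq[OF exec_within_Push exec_within_Seq[OF exec_within_reverse_onto
          exec_within_shift[OF computes_funD[OF H, of "(x, s)"]]]]]])
      (auto simp: single_def fun_eq_iff rep_Cons rep_prod_def * rev_code length_rev_code)
  have t: "top_in (?s0 0) letters"
    by (simp add: single_def top_in_letters)
  show ?case
    unfolding fold_cmd_def
    by (rule exec_within_mono[OF exec_within_While_True[OF t 1 IH[unfolded fold_cmd_def]]])
      (auto simp: algebra_simps)
qed

text \<open>A polynomial bound on the body does not prevent the accumulator from growing
  exponentially, so all intermediate accumulators are bounded by assumption.\<close>

lemma ptime_fold_raw:
  fixes xs :: "'e::repr \<Rightarrow> 'x::repr list" and b :: "'e \<Rightarrow> 's::repr"
  assumes "ptime (\<lambda>p. h (fst p) (snd p))" and "ptime xs" and "ptime b"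
    and B: "\<And>e ys zs. xs e = ys @ zs \<Longrightarrow> rsize (fold h ys (b e)) \<le> poly r (rsize e)"
  shows "ptime (\<lambda>e. fold h (xs e) (b e))"
proof -
  obtain H q where H: "computes_fun H q (\<lambda>p. h (fst p) (snd p))"
    using assms(1) by (rule ptimeE)
  obtain P p where P: "computes_fun P p (\<lambda>e. (xs e, b e))"
    using ptime_Pair[OF assms(2,3)] by (rule ptimeE)
  \<comment> \<open>After \<open>P\<close>, stack 0 holds the pair. The list is split off to stack
    1, and both parts are moved until the list is on stack 0 and the initial accumulator on stack 1,
    each in its original order.\<close>
  let ?c = "Seq (Seq P (Seq (take_block 0 1 (\<lambda>a. [a])) (Seq (reverse_onto 0 2) (Seq (reverse_onto 1 0) (reverse_onto 2 1)))))
    (Seq (fold_cmd H) (Seq (reverse_onto 1 2) (reverse_onto 2 0)))"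
  let ?N = "[:0, 1:] + p"
  let ?T = "[:300:] * (?N + r + [:1:]) + ?N * ([:100:] * (?N + r + [:1:]) + pcompose q ([:2:] * ?N + r + [:1:]))"
  have "exec_within ?c (single (rep e)) (poly ?T (rsize e)) (single (rep (fold h (xs e) (b e))))" for e
  proof -
    let ?n = "rsize e + poly p (rsize e)" and ?B = "poly r (rsize e)"
    have n: "2 * rsize (xs e) + rsize (b e) + 1 \<le> ?n"
      using computes_fun_size[OF P, of e] by simp
    have f: "rsize (fold h (xs e) (b e)) \<le> ?B" using B[of e "xs e" "[]"] by simp
    have 1: "exec_within (Seq P (Seq (take_block 0 1 (\<lambda>a. [a])) (Seq (reverse_onto 0 2) (Seq (reverse_onto 1 0) (reverse_onto 2 1)))))
        (single (rep e)) (poly p (rsize e) + 100 * ?n + 20) ((single (rep (xs e)))(1 := rep (b e)))"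
      using n
      by (intro exec_within_mono[OF exec_within_Seq[OF computes_funD[OF P, of e]
          exec_within_Seq[OF exec_within_take_block[where u = "rep (xs e)" and v = "rep (b e)"]
          exec_within_Seq[OF exec_within_reverse_onto exec_within_Seq[OF exec_within_reverse_onto exec_within_reverse_onto]]]]])
        (auto simp: single_def fun_eq_iff rep_prod_def)
    have "exec_within (fold_cmd H) ((single (rep (xs e)))(1 := rep (b e)))
      (rsize (xs e) * (100 * (?n + ?B + 1) + poly q (2 * ?n + ?B + 1)) + 1) ((single [])(1 := rep (fold h (xs e) (b e))))"
      using n by (intro exec_within_fold_cmd[OF H] B) auto
    then have 2: "exec_within (fold_cmd H) ((single (rep (xs e)))(1 := rep (b e)))
      (?n * (100 * (?n + ?B + 1) + poly q (2 * ?n + ?B + 1)) + 1) ((single [])(1 := rep (fold h (xs e) (b e))))"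
      by (rule exec_within_mono) (use n in \<open>auto intro!: mult_right_mono\<close>)
    have 3: "exec_within (Seq (reverse_onto 1 2) (reverse_onto 2 0)) ((single [])(1 := rep (fold h (xs e) (b e))))
      (60 * ?B + 3) (single (rep (fold h (xs e) (b e))))"
      using f by (intro exec_within_mono[OF exec_within_Seq[OF exec_within_reverse_onto exec_within_reverse_onto]])
        (auto simp: single_def fun_eq_iff)
    show ?thesis
      by (rule exec_within_mono[OF exec_within_Seq[OF 1 exec_within_Seq[OF 2 3]]])
        (auto simp: poly_pcompose)
  qed
  then show ?thesis by (rule ptimeI)
qed

text \<open>On a letter list, \<^const>\<open>rep\<close> spends three letters per letter of the word.\<close>

lemma ptime_computes_words:
  fixes f :: "letter list \<Rightarrow> letter list"
  assumes "ptime f"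
  obtains P p where "\<And>w. exec_within P (single w) (poly p (length w)) (single (f w))"
proof -
  obtain P p where P: "computes_fun P p f" using assms by (rule ptimeE)
  have expand: "exec_within (Seq (reverse_onto 0 1) (pass 1 0 (\<lambda>a. [One, a, Zero]) 2 (\<lambda>_. [])))
      (single w) (60 * length w + 5) (single (rep w))" for w :: "letter list"
  proof -
    have "concat (map (\<lambda>a. [One, a, Zero]) w) = rep w"
      by (induction w) (auto simp: rep_list_def rep_letter_def)
    then show ?thesis
      by (intro exec_within_mono[OF exec_within_Seq[OF exec_within_reverse_onto exec_within_pass]])
        (auto simp: single_def fun_eq_iff)
  qed
  let ?c = "While_top 0 letters (take_block 0 1 (\<lambda>a. [a]))"
  have compress: "exec_within ?c ((single (rep w))(1 := v)) (40 * length w + 1) ((single [])(1 := rev w @ v))"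
    for w v :: "letter list"
  proof (induction w arbitrary: v)
    case Nil
    show ?case
      by (rule exec_within_mono[OF exec_within_While_False]) (auto simp: single_def top_in_def)
  next
    case (Cons a w)
    have 1: "exec_within (take_block 0 1 (\<lambda>a. [a])) ((single (rep (a # w)))(1 := v)) 33 ((single (rep w))(1 := a # v))"
      by (rule exec_within_mono[OF exec_within_take_block[where u = "[a]" and v = "rep w"]])
        (auto simp: single_def fun_eq_iff rep_Cons rep_prod_def rep_letter_def)
    have t: "top_in (((single (rep (a # w)))(1 := v)) 0) letters"
      by (simp add: single_def top_in_letters)
    show ?case
      by (rule exec_within_mono[OF exec_within_While_True[OF t 1 Cons]]) auto
  qed
  have rep_w: "rsize w = 3 * length w" for w :: "letter list"
    by (induction w) auto
  let ?P = "Seq (Seq (reverse_onto 0 1) (pass 1 0 (\<lambda>a. [One, a, Zero]) 2 (\<lambda>_. [])))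
    (Seq P (Seq ?c (reverse_onto 1 0)))"
  have "exec_within ?P (single w)
      (poly ([:20, 300:] + [:100:] * pcompose p [:0, 3:]) (length w)) (single (f w))" for w
  proof -
    have l: "3 * length (f w) \<le> 3 * length w + poly p (3 * length w)"
      using computes_fun_size[OF P, of w] by (simp add: rep_w)
    have e: "(single (rep (f w)))(1 := []) = single (rep (f w))" by (auto simp: single_def)
    show ?thesis
      using l
      by (intro exec_within_mono[OF exec_within_Seq[OF expand exec_within_Seq[OF computes_funD[OF P]
          exec_within_Seq[OF compress[of "f w" "[]", unfolded e] exec_within_reverse_onto]]]])
        (auto simp: single_def fun_eq_iff poly_pcompose rep_w mult.commute[of _ 3])
  qed
  then show ?thesis by (rule that)
qed

theorem ptime_turing_machine:
  fixes f :: "letter list \<Rightarrow> letter list"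
  assumes "ptime f"
  obtains M p where "wf_tm M" "\<And>w. computes_within M (poly p (length w)) w (f w)"
proof -
  obtain P p where P: "\<And>w. exec_within P (single w) (poly p (length w)) (single (f w))"
    by (rule ptime_computes_words[OF assms]) blast
  obtain N where "regs P \<subseteq> {..<N}"
    using finite_regs[of P] by (metis finite_nat_iff_bounded)
  then have N: "regs P \<subseteq> {..<Suc N}" by auto
  show ?thesis
    using that[OF wf_machine[of "Suc N" P] computes_within_machine[OF P N]] by simp
qed

section \<open>Lists and unary numbers\<close>

named_theorems ptime_intros

lemmas [ptime_intros] = ptime_id ptime_const ptime_Pair ptime_fst ptime_snd ptime_If
  ptime_letter_eq ptime_not_Nil

lemma ptime_lift2:
  "ptime (\<lambda>p. F (fst p) (snd p)) \<Longrightarrow> ptime f \<Longrightarrow> ptime g \<Longrightarrow> ptime (\<lambda>e. F (f e) (g e))"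
  using ptime_comp[OF ptime_Pair, of f g "\<lambda>p. F (fst p) (snd p)"] by simp

lemma ptime_lift3:
  assumes "ptime (\<lambda>p. F (fst p) (fst (snd p)) (snd (snd p)))" "ptime f" "ptime g" "ptime h"
  shows "ptime (\<lambda>e. F (f e) (g e) (h e))"
  using ptime_comp[OF ptime_Pair[OF assms(2) ptime_Pair[OF assms(3,4)]] assms(1)] by simp

lemma ptime_Not [ptime_intros]: "ptime b \<Longrightarrow> ptime (\<lambda>e. \<not> b e)"
  by (rule ptime_cast[OF ptime_If[of b, OF _ ptime_const[of False] ptime_const[of True]]]) auto

lemma ptime_conj [ptime_intros]: "ptime b \<Longrightarrow> ptime c \<Longrightarrow> ptime (\<lambda>e. b e \<and> c e)"
  by (rule ptime_cast[OF ptime_If[of b c, OF _ _ ptime_const[of False]]]) auto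

lemma ptime_disj [ptime_intros]: "ptime b \<Longrightarrow> ptime c \<Longrightarrow> ptime (\<lambda>e. b e \<or> c e)"
  by (rule ptime_cast[OF ptime_If[of b, OF _ ptime_const[of True], of c]]) auto

lemma ptime_xor [ptime_intros]: "ptime b \<Longrightarrow> ptime c \<Longrightarrow> ptime (\<lambda>e. b e \<noteq> (c e :: bool))"
proof -
  assume "ptime b" "ptime c"
  then have "ptime (\<lambda>e. if b e then \<not> c e else c e)" by (intro ptime_intros)
  then show ?thesis by (rule ptime_cast) (auto intro: arg_cong[of _ _ rep])
qed

lemma ptime_fold_bounded:
  fixes xs :: "'e::repr \<Rightarrow> 'x::repr list" and b :: "'e \<Rightarrow> 's::repr"
  assumes "ptime xs" and "ptime b" and "ptime (\<lambda>p. h (fst p) (fst (snd p)) (snd (snd p)))"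
    and B: "\<And>e ys zs. xs e = ys @ zs \<Longrightarrow> rsize (fold (h e) ys (b e)) \<le> poly r (rsize e)"
  shows "ptime (\<lambda>e. fold (h e) (xs e) (b e))"
proof -
  \<comment> \<open>The accumulator carries the environment \<open>e\<close> along, which lets the
    loop body depend on it.\<close>
  define h' where "h' x p = (h (snd p) x (fst p), snd p)" for x and p :: "'s \<times> 'e"
  have fold: "fold h' ys (s, e) = (fold (h e) ys s, e)" for ys s e
    by (induction ys arbitrary: s) (auto simp: h'_def)
  have "ptime (\<lambda>q. h (snd (snd q)) (fst q) (fst (snd q)))"
    using assms(3) by (rule ptime_lift3) (intro ptime_intros)+
  then have "ptime (\<lambda>p. h' (fst p) (snd p))"
    unfolding h'_def by (intro ptime_intros)
  moreover have "rsize (fold h' ys (b e, e)) \<le> poly ([:1, 1:] + [:2:] * r) (rsize e)" if "xs e = ys @ zs" for e ys zs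
    using B[OF that] by (simp add: fold)
  ultimately have "ptime (\<lambda>e. fst (fold h' (xs e) (b e, e)))"
    using assms(1,2) by (intro ptime_fst ptime_fold_raw[where r = "[:1, 1:] + [:2:] * r"] ptime_intros)
  then show ?thesis by (simp add: fold)
qed

text \<open>The increment per step is polynomial in the environment and the element but independent
  of the accumulator. Increments therefore add up over the list instead of compounding.\<close>

lemma ptime_fold:
  fixes xs :: "'e::repr \<Rightarrow> 'x::repr list" and b :: "'e \<Rightarrow> 's::repr"
  assumes "ptime xs" and "ptime b" and "ptime (\<lambda>p. h (fst p) (fst (snd p)) (snd (snd p)))"
    and growth: "\<And>e x s. x \<in> set (xs e) \<Longrightarrow> rsize (h e x s) \<le> rsize s + poly q (rsize (e, x))"
  shows "ptime (\<lambda>e. fold (h e) (xs e) (b e))"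
proof -
  obtain p1 where p1: "\<And>e. rsize (xs e) \<le> poly p1 (rsize e)" using assms(1) by (rule ptime_size) blast
  obtain p2 where p2: "\<And>e. rsize (b e) \<le> poly p2 (rsize e)" using assms(2) by (rule ptime_size) blast
  \<comment> \<open>\<open>rsize (e, x)\<close> is at most \<open>1 + 2 * rsize e\<close> plus the
    size of the whole list, so one polynomial in \<open>rsize e\<close> bounds every
    increment.\<close>
  let ?q = "pcompose q ([:1, 2:] + p1)"
  show ?thesis
  proof (rule ptime_fold_bounded[where r = "p2 + p1 * ?q"])
    fix e ys zs assume xs: "xs e = ys @ zs"
    have *: "rsize (fold (h e) us s) \<le> rsize s + length us * poly ?q (rsize e)" if "set us \<subseteq> set (xs e)" for us s
      using that
    proof (induction us arbitrary: s)
      case (Cons u us)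
      have "rsize (e, u) \<le> poly ([:1, 2:] + p1) (rsize e)"
        using rsize_mem[of u "xs e"] p1[of e] Cons.prems by simp
      then have "rsize (h e u s) \<le> rsize s + poly ?q (rsize e)"
        using growth[of u e s] Cons.prems poly_nat_mono[of _ _ q] unfolding poly_pcompose
        by (meson add_left_mono list.set_intros(1) order_trans subsetD)
      then show ?case using Cons.IH[of "h e u s"] Cons.prems by simp
    qed simp
    have "length ys \<le> poly p1 (rsize e)"
      using xs p1[of e] length_le_rsize[of "xs e"] by simp
    then have "length ys * poly ?q (rsize e) \<le> poly p1 (rsize e) * poly ?q (rsize e)" by (rule mult_right_mono) simp
    moreover have "set ys \<subseteq> set (xs e)" using xs by simp
    ultimately show "rsize (fold (h e) ys (b e)) \<le> poly (p2 + p1 * ?q) (rsize e)"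
      using *[of ys "b e"] p2[of e] unfolding poly_add poly_mult by linarith
  qed (use assms in auto)
qed

lemma ptime_Cons [ptime_intros]: "ptime f \<Longrightarrow> ptime g \<Longrightarrow> ptime (\<lambda>e. f e # g e)"
  by (erule ptime_cast[OF ptime_Pair]) (auto simp: rep_Cons)

lemma ptime_rev [ptime_intros]:
  fixes f :: "'e::repr \<Rightarrow> 'x::repr list"
  assumes "ptime f" shows "ptime (\<lambda>e. rev (f e))"
proof -
  have "ptime (\<lambda>e. fold (\<lambda>x s. x # s) (f e) [])"
    by (rule ptime_fold[where q = "[:1, 2:]"]) (use assms in \<open>auto intro!: ptime_intros\<close>)
  then show ?thesis by (simp add: rev_conv_fold)
qed

lemma ptime_foldr:
  fixes xs :: "'e::repr \<Rightarrow> 'x::repr list" and b :: "'e \<Rightarrow> 's::repr"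
  assumes "ptime xs" and "ptime b" and "ptime (\<lambda>p. h (fst p) (fst (snd p)) (snd (snd p)))"
    and growth: "\<And>e x s. x \<in> set (xs e) \<Longrightarrow> rsize (h e x s) \<le> rsize s + poly q (rsize (e, x))"
  shows "ptime (\<lambda>e. foldr (h e) (xs e) (b e))"
  unfolding foldr_conv_fold
  by (rule ptime_fold[where q = q]) (use assms in \<open>auto intro!: ptime_intros\<close>)

lemma ptime_append [ptime_intros]:
  assumes "ptime f" "ptime g" shows "ptime (\<lambda>e. f e @ g e)"
proof -
  have "ptime (\<lambda>e. foldr (\<lambda>x s. x # s) (f e) (g e))"
    by (rule ptime_foldr[where q = "[:1, 2:]"]) (use assms in \<open>auto intro!: ptime_intros\<close>)
  moreover have "foldr (\<lambda>x s. x # s) xs ys = xs @ ys" for xs ys :: "'b list"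
    by (induction xs) auto
  ultimately show ?thesis by simp
qed

lemma ptime_map [ptime_intros]:
  assumes "ptime (\<lambda>p. g (fst p) (snd p))" and "ptime xs"
  shows "ptime (\<lambda>e. map (g e) (xs e))"
proof -
  obtain q where q: "\<And>p. rsize (g (fst p) (snd p)) \<le> poly q (rsize p)"
    using assms(1) by (rule ptime_size) blast
  have "ptime (\<lambda>p. g (fst p) (fst (snd p)))"
    by (rule ptime_lift2[of g, OF assms(1)]) (intro ptime_intros)+
  then have "ptime (\<lambda>e. foldr (\<lambda>x s. g e x # s) (xs e) [])"
    by (intro ptime_foldr[where q = "[:1:] + [:2:] * q"])
      (use assms q[of "(e, x)" for e x] in \<open>auto intro!: ptime_intros\<close>)
  moreover have "foldr (\<lambda>x s. g e x # s) ys [] = map (g e) ys" for e ys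
    by (induction ys) auto
  ultimately show ?thesis by simp
qed

lemma ptime_concat [ptime_intros]:
  assumes "ptime f" shows "ptime (\<lambda>e. concat (f e))"
proof -
  have "ptime (\<lambda>e. foldr (\<lambda>x s. x @ s) (f e) [])"
    by (rule ptime_foldr[where q = "[:0, 1:]"]) (use assms in \<open>auto intro!: ptime_intros\<close>)
  then show ?thesis by (simp add: concat_conv_foldr)
qed

lemma ptime_tl [ptime_intros]: "ptime f \<Longrightarrow> ptime (\<lambda>e. tl (f e))"
  by (drule ptime_uncons[of f "(undefined, [])", THEN ptime_snd])
    (erule ptime_cast, auto simp: uncons_def)

definition first :: "'a \<Rightarrow> 'a list \<Rightarrow> 'a" where
  "first d xs = (if xs = [] then d else hd xs)"

lemma first_simps [simp]: "first d [] = d" "first d (x # xs) = x"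
  by (auto simp: first_def)

lemma ptime_first [ptime_intros]: "ptime f \<Longrightarrow> ptime (\<lambda>e. first d (f e))"
  by (drule ptime_uncons[of f "(d, [])", THEN ptime_fst])
    (erule ptime_cast, auto simp: uncons_def first_def)

lemma ptime_replicate_unit [ptime_intros]: "ptime f \<Longrightarrow> ptime (\<lambda>e. replicate (f e) ())"
  by (erule ptime_cast) (simp add: rep_nat_eq)

lemma ptime_length [ptime_intros]:
  assumes "ptime f" shows "ptime (\<lambda>e. length (f e))"
proof (rule ptime_cast)
  show "ptime (\<lambda>e. map (\<lambda>_. ()) (f e))" by (intro ptime_intros assms)
qed (simp add: rep_nat_eq map_replicate_const)

lemma ptime_replicate [ptime_intros]:
  assumes "ptime n" "ptime x" shows "ptime (\<lambda>e. replicate (n e) (x e))"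
proof -
  have "ptime (\<lambda>p. x (fst p))"
    by (rule ptime_comp[OF _ assms(2)]) (intro ptime_intros)
  then have "ptime (\<lambda>e. map (\<lambda>_. x e) (replicate (n e) ()))"
    using assms(1) by (intro ptime_intros)
  then show ?thesis by simp
qed

lemma ptime_plus [ptime_intros]:
  assumes "ptime f" "ptime g" shows "ptime (\<lambda>e. f e + g e :: nat)"
  by (rule ptime_cast[of "\<lambda>e. replicate (f e) () @ replicate (g e) ()"])
    (use assms in \<open>auto intro!: ptime_intros simp: rep_nat_eq replicate_add\<close>)

lemma ptime_Suc [ptime_intros]: "ptime f \<Longrightarrow> ptime (\<lambda>e. Suc (f e))"
  using ptime_plus[OF _ ptime_const, of f 1] by simp

lemma ptime_times [ptime_intros]:
  assumes "ptime f" "ptime g" shows "ptime (\<lambda>e. f e * g e :: nat)"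
proof -
  have "ptime (\<lambda>p. g (fst p))"
    by (rule ptime_comp[OF _ assms(2)]) (intro ptime_intros)
  then have "ptime (\<lambda>e. length (concat (map (\<lambda>_. replicate (g e) ()) (replicate (f e) ()))))"
    using assms(1) by (intro ptime_intros)
  then show ?thesis by (simp add: length_concat sum_list_replicate)
qed

lemma rsize_tl: "rsize (tl xs) \<le> rsize xs"
  by (cases xs) auto

lemma ptime_drop [ptime_intros]:
  assumes "ptime n" "ptime f" shows "ptime (\<lambda>e. drop (n e) (f e))"
proof -
  have "ptime (\<lambda>e. fold (\<lambda>_ s. tl s) (replicate (n e) ()) (f e))"
    by (rule ptime_fold[where q = 0]) (use assms rsize_tl in \<open>auto intro!: ptime_intros\<close>)
  moreover have "fold (\<lambda>_ s. tl s) (replicate k ()) xs = drop k xs" for k and xs :: "'b list"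
    by (induction k arbitrary: xs) (auto simp: drop_Suc)
  ultimately show ?thesis by simp
qed

lemma ptime_minus [ptime_intros]:
  assumes "ptime f" "ptime g" shows "ptime (\<lambda>e. f e - g e :: nat)"
proof (rule ptime_cast)
  show "ptime (\<lambda>e. drop (g e) (replicate (f e) ()))" by (intro ptime_intros assms)
qed (simp add: rep_nat_eq)

lemma ptime_nat_eq [ptime_intros]:
  assumes "ptime f" "ptime g" shows "ptime (\<lambda>e. f e = (g e :: nat))"
proof -
  have "ptime (\<lambda>e. \<not> (replicate ((f e - g e) + (g e - f e)) () \<noteq> []))"
    using assms by (intro ptime_intros)
  then show ?thesis by (rule ptime_cast) (auto intro!: arg_cong[of _ _ rep])
qed

definition lookup :: "'a \<Rightarrow> 'a list \<Rightarrow> nat \<Rightarrow> 'a" where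
  "lookup d xs n = first d (drop n xs)"

lemma lookup_eq: "lookup d xs n = (if n < length xs then xs ! n else d)"
  by (auto simp: lookup_def first_def hd_drop_conv_nth)

lemma ptime_lookup [ptime_intros]: "ptime f \<Longrightarrow> ptime n \<Longrightarrow> ptime (\<lambda>e. lookup d (f e) (n e))"
  unfolding lookup_def by (intro ptime_intros)

lemma ptime_upt [ptime_intros]:
  assumes "ptime n" shows "ptime (\<lambda>e. [0..<n e])"
proof -
  \<comment> \<open>The list is built from its last element downwards; the length of the part
    already built determines the next element.\<close>
  let ?h = "\<lambda>n x s. (n - Suc (length s)) # s"
  have "ptime (\<lambda>e. fold (?h e) (replicate e ()) [])"
    by (rule ptime_fold[where q = "[:1, 2:]"]) (auto intro!: ptime_intros)
  moreover have "fold (?h e) (replicate k ()) [] = [e - k..<e]" if "k \<le> e" for e k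
    using that
  proof (induction k)
    case (Suc k)
    have "replicate (Suc k) () = replicate k () @ [()]" by (simp add: replicate_append_same)
    then show ?case using Suc by (simp add: upt_rec[of "e - Suc k"] Suc_diff_Suc del: replicate_Suc)
  qed simp
  ultimately have "ptime (\<lambda>n. [0..<n])" by simp
  then show ?thesis by (rule ptime_comp[OF assms])
qed


section \<open>Binary arithmetic\<close>

primrec val :: "bool list \<Rightarrow> int" where
  "val [] = 0"
| "val (b # bs) = of_bool b + 2 * val bs"

lemma val_nonneg: "0 \<le> val xs"
  by (induction xs) auto

lemma val_less: "val xs < 2 ^ length xs"
  by (induction xs) auto

lemma val_append: "val (xs @ ys) = val xs + 2 ^ length xs * val ys"
  by (induction xs) (auto simp: algebra_simps)

lemma rsize_bools: "rsize (xs :: bool list) = 3 * length xs"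
  by (induction xs) auto

text \<open>Addition (\<open>s = False\<close>) or subtraction (\<open>s = True\<close>) modulo \<open>2 ^ n\<close> with carry or borrow \<open>c\<close>.\<close>

primrec ripple :: "bool \<Rightarrow> nat \<Rightarrow> bool \<Rightarrow> bool list \<Rightarrow> bool list \<Rightarrow> bool list" where
  "ripple s 0 c xs ys = []"
| "ripple s (Suc n) c xs ys =
    ((first False xs \<noteq> first False ys) \<noteq> c) #
    ripple s n (if first False ys \<noteq> c then first False xs \<noteq> s else c) (tl xs) (tl ys)"

lemma length_ripple [simp]: "length (ripple s n c xs ys) = n"
  by (induction n arbitrary: c xs ys) auto

lemma val_first: "val xs = of_bool (first False xs) + 2 * val (tl xs)"
  by (cases xs) auto

lemma val_ripple:
  "val (ripple s n c xs ys) = (val xs + (if s then - 1 else 1) * (val ys + of_bool c)) mod 2 ^ n"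
proof (induction n arbitrary: c xs ys)
  case (Suc n)
  define x y where "x = first False xs" and "y = first False ys"
  define t where "t = (if s then - 1 else 1 :: int)"
  define A where "A = val xs + t * (val ys + of_bool c)"
  define c' where "c' = (if y \<noteq> c then x \<noteq> s else c)"
  define A' where "A' = val (tl xs) + t * (val (tl ys) + of_bool c')"
  define o' where "o' = ((x \<noteq> y) \<noteq> c)"
  \<comment> \<open>One column of the computation: if \<open>y\<close> and \<open>c\<close> differ
    they add up to one, so the carry out is \<open>x\<close> and the borrow out its negation; if
    they agree, carry and borrow out both equal \<open>c\<close>.\<close>
  have A: "A = of_bool o' + 2 * A'"
    unfolding A_def A'_def o'_def c'_def t_def val_first[of xs] val_first[of ys] x_def[symmetric] y_def[symmetric]
    by (cases x; cases y; cases c; cases s) auto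
  have "A mod 2 ^ Suc n = 2 * (A div 2 mod 2 ^ n) + A mod 2"
    using zmod_zmult2_eq[of "2 ^ n" A 2] by simp
  also have "A div 2 = A'" using A by simp
  also have "A mod 2 = of_bool o'" using A by simp
  finally have A_mod: "A mod 2 ^ Suc n = 2 * (A' mod 2 ^ n) + of_bool o'" .
  have "val (ripple s (Suc n) c xs ys) = of_bool o' + 2 * val (ripple s n c' (tl xs) (tl ys))"
    by (simp only: ripple.simps val.simps x_def y_def o'_def c'_def)
  also have "val (ripple s n c' (tl xs) (tl ys)) = A' mod 2 ^ n"
    by (simp only: Suc A'_def t_def)
  finally show ?case
    unfolding A_def[unfolded t_def, symmetric] A_mod by simp
qed simp

declare ripple.simps(2) [simp del]

text \<open>The recursion of \<open>ripple\<close> as a fold step, with state carry, remaining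
  digits of both operands, and reversed output.\<close>

definition ripple_step :: "bool \<Rightarrow> unit \<Rightarrow> bool \<times> bool list \<times> bool list \<times> bool list \<Rightarrow> bool \<times> bool list \<times> bool list \<times> bool list" where
  "ripple_step s u p =
    (let c = fst p; xs = fst (snd p); ys = fst (snd (snd p)); zs = snd (snd (snd p)) in
     (if first False ys \<noteq> c then first False xs \<noteq> s else c, tl xs, tl ys, ((first False xs \<noteq> first False ys) \<noteq> c) # zs))"

lemma ptime_ripple [ptime_intros]:
  assumes "ptime n" "ptime xs" "ptime ys"
  shows "ptime (\<lambda>e. ripple s (n e) c (xs e) (ys e))"
proof -
  have fold: "snd (snd (snd (fold (ripple_step s) (replicate n ()) (c, xs, ys, zs)))) = rev (ripple s n c xs ys) @ zs"
    for n c xs ys zs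
    by (induction n arbitrary: c xs ys zs) (auto simp: ripple_step_def ripple.simps(2))
  have "ptime (\<lambda>e. fold (ripple_step s) (replicate (n e) ()) (c, xs e, ys e, []))"
  proof (rule ptime_fold[where q = "[:10:]"])
    show "ptime (\<lambda>p :: 'a \<times> unit \<times> bool \<times> bool list \<times> bool list \<times> bool list. ripple_step s (fst (snd p)) (snd (snd p)))"
      unfolding ripple_step_def Let_def by (intro ptime_intros)
    show "rsize (ripple_step s x p) \<le> rsize p + poly [:10:] (rsize (e, x))" for e :: 'a and x p
      using rsize_tl[of "fst (snd p)"] rsize_tl[of "fst (snd (snd p))"]
      by (cases p) (auto simp: ripple_step_def)
  qed (intro ptime_intros assms)+
  then have "ptime (\<lambda>e. rev (snd (snd (snd (fold (ripple_step s) (replicate (n e) ()) (c, xs e, ys e, []))))))"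
    by (intro ptime_intros)
  then show ?thesis by (simp only: fold append_Nil2 rev_rev_ident)
qed

text \<open>One digit more than the longer operand excludes overflow; the maximum is expressed by
  truncated subtraction, for which a closure rule is available.\<close>

definition add :: "bool list \<Rightarrow> bool list \<Rightarrow> bool list" where
  "add xs ys = ripple False (Suc (length xs + (length ys - length xs))) False xs ys"

lemma length_add: "length (add xs ys) = Suc (max (length xs) (length ys))"
  by (simp add: add_def)

lemma val_add: "val (add xs ys) = val xs + val ys"
proof -
  have "val xs < 2 ^ max (length xs) (length ys)" "val ys < 2 ^ max (length xs) (length ys)"
    using val_less[of xs] val_less[of ys]
    by (auto elim!: less_le_trans intro!: power_increasing)
  moreover have "length xs + (length ys - length xs) = max (length xs) (length ys)" by simp
  ultimately show ?thesis
    using val_nonneg[of xs] val_nonneg[of ys] by (simp add: add_def val_ripple)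
qed

lemma ptime_add [ptime_intros]: "ptime f \<Longrightarrow> ptime g \<Longrightarrow> ptime (\<lambda>e. add (f e) (g e))"
  unfolding add_def by (intro ptime_intros)

definition mul :: "bool list \<Rightarrow> bool list \<Rightarrow> bool list" where
  "mul xs ys = foldr (\<lambda>x acc. add (False # acc) (if x then ys else [])) xs []"

text \<open>The coefficient 1 of \<open>length ys\<close> matters: with the accumulator as second
  factor, repeated multiplication grows additively, as the fold rules demand.\<close>

lemma length_mul: "length (mul xs ys) \<le> length ys + 2 * length xs"
  by (induction xs) (auto simp: mul_def length_add)

lemma val_mul: "val (mul xs ys) = val xs * val ys"
  by (induction xs) (auto simp: mul_def val_add algebra_simps)

lemma ptime_mul [ptime_intros]:
  assumes "ptime f" "ptime g" shows "ptime (\<lambda>e. mul (f e) (g e))"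
proof -
  have "ptime (\<lambda>p. foldr (\<lambda>x acc. add (False # acc) (if x then snd p else [])) (fst p) [])"
  proof (rule ptime_foldr[where q = "[:6, 1:]"])
    show "rsize (add (False # acc) (if x then snd p else [])) \<le> rsize acc + poly [:6, 1:] (rsize (p, x))"
      for p :: "bool list \<times> bool list" and x acc
      by (cases p) (auto simp: rsize_bools length_add max_def)
  qed (intro ptime_intros)+
  then have "ptime (\<lambda>p. mul (fst p) (snd p))" by (simp add: mul_def)
  then show ?thesis using assms by (rule ptime_lift2)
qed

definition mul_all :: "bool list list \<Rightarrow> bool list" where
  "mul_all xss = foldr mul xss [True]"

lemma val_mul_all: "val (mul_all xss) = prod_list (map val xss)"
  by (induction xss) (auto simp: mul_all_def val_mul)

lemma ptime_mul_all [ptime_intros]: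
  assumes "ptime f" shows "ptime (\<lambda>e. mul_all (f e))"
  unfolding mul_all_def
proof (rule ptime_foldr[where q = "[:0, 6:]"])
  show "rsize (mul x s) \<le> rsize s + poly [:0, 6:] (rsize (e, x))" for e :: 'a and x s
    using length_mul[of x s] by (simp add: rsize_bools)
qed (intro ptime_intros assms)+

section \<open>Canonical binary output\<close>

primrec strip :: "bool list \<Rightarrow> bool list" where
  "strip [] = []"
| "strip (b # bs) = (if b \<or> strip bs \<noteq> [] then b # strip bs else [])"

lemma ptime_strip [ptime_intros]:
  assumes "ptime f" shows "ptime (\<lambda>e. strip (f e))"
proof -
  have "ptime (\<lambda>e. foldr (\<lambda>b s. if b \<or> s \<noteq> [] then b # s else []) (f e) [])"
    by (rule ptime_foldr[where q = "[:3:]"]) ((intro ptime_intros assms)+, auto)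
  moreover have "foldr (\<lambda>b s. if b \<or> s \<noteq> [] then b # s else []) xs [] = strip xs" for xs
    by (induction xs) auto
  ultimately show ?thesis by simp
qed

definition bit_letter :: "bool \<Rightarrow> letter" where
  "bit_letter b = (if b then One else Zero)"

lemma ptime_bit_letter [ptime_intros]: "ptime f \<Longrightarrow> ptime (\<lambda>e. bit_letter (f e))"
  unfolding bit_letter_def by (intro ptime_intros)

lemma strip_eq_Nil_iff: "strip xs = [] \<longleftrightarrow> val xs = 0"
  by (induction xs) auto

lemma bits_val: "bits (nat (val xs)) = map bit_letter (strip xs)"
proof (induction xs)
  case (Cons b xs)
  have n: "nat (val (b # xs)) = of_bool b + 2 * nat (val xs)"
    by (simp add: nat_add_distrib nat_mult_distrib val_nonneg)
  show ?case
    unfolding n using Cons strip_eq_Nil_iff[of xs] val_nonneg[of xs]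
    by (subst bits.simps) (auto simp: bit_letter_def)
qed (simp add: bits.simps)

lemma val_bits: "val (map (\<lambda>a. a = One) (bits n)) = int n"
proof (induction n rule: bits.induct)
  case (1 n)
  show ?case
    using 1 by (subst bits.simps) (auto simp: zdiv_int elim: evenE oddE)
qed

text \<open>The sign of the difference is the top bit of its two's complement.\<close>

definition diff :: "bool list \<Rightarrow> bool list \<Rightarrow> bool \<times> bool list" where
  "diff xs ys =
    (let n = Suc (length xs + length ys); d = ripple True n False xs ys in
     if first False (rev d) then (True, strip (ripple True n False ys xs)) else (False, strip d))"

lemma ptime_diff [ptime_intros]:
  assumes "ptime f" "ptime g" shows "ptime (\<lambda>e. diff (f e) (g e))"
  unfolding diff_def Let_def by (intro ptime_intros assms)

lemma first_rev_iff:
  assumes "length d = Suc n"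
  shows "first False (rev d) \<longleftrightarrow> val d \<ge> 2 ^ n"
proof -
  obtain ds b where d: "d = ds @ [b]" using assms by (metis length_Suc_conv_rev)
  then show ?thesis using assms val_less[of ds] val_nonneg[of ds] by (auto simp: val_append)
qed

definition write_int :: "bool \<times> bool list \<Rightarrow> letter list" where
  "write_int p = bit_letter (fst p) # map bit_letter (snd p) @ [Sep]"

lemma ptime_write_int [ptime_intros]:
  assumes "ptime f" shows "ptime (\<lambda>e. write_int (f e))"
proof -
  have "ptime write_int" unfolding write_int_def by (intro ptime_intros)
  then show ?thesis by (rule ptime_comp[OF assms])
qed

text \<open>Both values are below \<open>2 ^ n\<close>, so modulo \<open>2 ^ Suc n\<close> a
  nonnegative difference stays below \<open>2 ^ n\<close> while a negative one wraps to at least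
  \<open>2 ^ n\<close>. Stripping yields the canonical digits of \<open>bits\<close>.\<close>

lemma write_int_diff: "write_int (diff xs ys) = enc_int (val xs - val ys)"
proof -
  define n where "n = length xs + length ys"
  define D where "D = ripple True (Suc n) False xs ys"
  have less: "val xs < 2 ^ n" "val ys < 2 ^ n"
    using val_less[of xs] val_less[of ys] unfolding n_def
    by (auto elim!: less_le_trans intro!: power_increasing)
  have D: "val D = (val xs - val ys) mod 2 ^ Suc n"
    by (simp add: D_def val_ripple)
  have D': "val (ripple True (Suc n) False ys xs) = (val ys - val xs) mod 2 ^ Suc n"
    by (simp only: val_ripple) simp
  show ?thesis
  proof (cases "val xs < val ys")
    case True
    have "(val xs - val ys) mod 2 ^ Suc n = (val xs - val ys + 2 ^ Suc n) mod 2 ^ Suc n" by simp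
    also have "\<dots> = val xs - val ys + 2 ^ Suc n"
      using True less val_nonneg[of xs] by (intro mod_pos_pos_trivial) simp_all
    finally have "val D \<ge> 2 ^ n" using less val_nonneg[of xs] unfolding D by simp
    then have "first False (rev D)" using first_rev_iff[of D n] by (simp add: D_def)
    moreover have "val (ripple True (Suc n) False ys xs) = val ys - val xs"
      unfolding D' using True less val_nonneg[of xs] by (intro mod_pos_pos_trivial) auto
    ultimately show ?thesis
      using True bits_val[of "ripple True (Suc n) False ys xs"]
      by (simp add: write_int_def diff_def Let_def enc_int_def bit_letter_def flip: n_def D_def)
  next
    case False
    then have vD: "val D = val xs - val ys"
      unfolding D using less val_nonneg[of ys] by (intro mod_pos_pos_trivial) auto
    then have "\<not> val D \<ge> 2 ^ n" using less val_nonneg[of ys] by simp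
    then have "\<not> first False (rev D)" using first_rev_iff[of D n] by (simp add: D_def)
    then show ?thesis
      using False bits_val[of D] vD
      by (simp add: write_int_def diff_def Let_def enc_int_def bit_letter_def flip: n_def D_def)
  qed
qed


section \<open>The reduction as a polynomial-time function on words\<close>

text \<open>Used from right to left: a \<open>Sep\<close> opens a new empty token in front, and
  other letters extend the front token.\<close>

definition toks_step :: "letter \<Rightarrow> letter list list \<Rightarrow> letter list list" where
  "toks_step a ts = (if a = Sep then [] # ts else (a # first [] ts) # tl ts)"

definition toks :: "letter list \<Rightarrow> letter list list" where
  "toks w = foldr toks_step w []"

lemma ptime_toks [ptime_intros]:
  assumes "ptime f" shows "ptime (\<lambda>e. toks (f e))"
  unfolding toks_def
proof (rule ptime_foldr[where q = "[:10:]"])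
  show "ptime (\<lambda>p. toks_step (fst (snd p)) (snd (snd p)))"
    unfolding toks_step_def by (intro ptime_intros)
  show "rsize (toks_step a ts) \<le> rsize ts + poly [:10:] (rsize (e, a))" for e :: 'a and a ts
    by (cases ts) (auto simp: toks_step_def)
qed (intro ptime_intros assms)+

lemma toks_token:
  assumes "Sep \<notin> set t" shows "toks (t @ Sep # w) = t # toks w"
  using assms by (induction t) (auto simp: toks_def toks_step_def)

text \<open>The flag says that a second component, met first from the right, waits for its
  partner.\<close>

definition pair_step ::
  "letter list \<Rightarrow> bool \<times> letter list \<times> (letter list \<times> letter list) list
    \<Rightarrow> bool \<times> letter list \<times> (letter list \<times> letter list) list" where
  "pair_step t s = (if fst s then (False, [], (t, fst (snd s)) # snd (snd s)) else (True, t, snd (snd s)))"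

definition pairs :: "letter list list \<Rightarrow> (letter list \<times> letter list) list" where
  "pairs ts = snd (snd (foldr pair_step ts (False, [], [])))"

lemma ptime_pairs [ptime_intros]:
  assumes "ptime f" shows "ptime (\<lambda>e. pairs (f e))"
proof -
  have "ptime (\<lambda>e. foldr pair_step (f e) (False, [], []))"
  proof (rule ptime_foldr[where q = "[:10, 10:]"])
    show "ptime (\<lambda>p. pair_step (fst (snd p)) (snd (snd p)))"
      unfolding pair_step_def by (intro ptime_intros)
    show "rsize (pair_step t s) \<le> rsize s + poly [:10, 10:] (rsize (e, t))" for e :: 'a and t s
      by (cases s) (auto simp: pair_step_def)
  qed (intro ptime_intros assms)+
  then show ?thesis unfolding pairs_def by (intro ptime_intros)
qed

lemma pairs_concat: "pairs (concat (map (\<lambda>x. [f x, g x]) xs)) = map (\<lambda>x. (f x, g x)) xs"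
proof -
  have "foldr pair_step (concat (map (\<lambda>x. [f x, g x]) xs)) (False, [], []) =
      (False, [], map (\<lambda>x. (f x, g x)) xs)"
    by (induction xs) (auto simp: pair_step_def)
  then show ?thesis by (simp add: pairs_def)
qed

definition magnitude :: "letter list \<Rightarrow> bool list" where
  "magnitude t = map (\<lambda>a. a = One) (tl t)"

text \<open>Entry \<open>p\<close> times the product of all denominators, computed without division.\<close>

definition cleared :: "(letter list \<times> letter list) list \<Rightarrow> nat \<Rightarrow> bool \<times> bool list" where
  "cleared ps p =
    (first Zero (fst (lookup ([], []) ps p)) = One,
     mul_all (map (\<lambda>q. magnitude (if q = p then fst (lookup ([], []) ps q) else snd (lookup ([], []) ps q)))
       [0..<length ps]))"

definition cleared_list :: "(letter list \<times> letter list) list \<Rightarrow> (bool \<times> bool list) list" where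
  "cleared_list ps = map (cleared ps) [0..<length ps]"

lemma ptime_cleared_list [ptime_intros]:
  assumes "ptime f" shows "ptime (\<lambda>e. cleared_list (f e))"
proof -
  have "ptime cleared_list"
    unfolding cleared_list_def cleared_def magnitude_def by (intro ptime_intros)
  then show ?thesis by (rule ptime_comp[OF assms])
qed

text \<open>Row-major position in the flat list of all matrices. Positions behind its end give
  \<open>(False, [])\<close>, which stands for zero.\<close>

definition entry_at :: "nat \<Rightarrow> (bool \<times> bool list) list \<Rightarrow> nat \<Rightarrow> nat \<Rightarrow> nat \<Rightarrow> bool \<times> bool list" where
  "entry_at m es k i j = lookup (False, []) es (k * m * m + i * m + j)"

definition neg_prod :: "bool \<times> bool list \<Rightarrow> bool \<times> bool list \<Rightarrow> bool \<times> bool list" where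
  "neg_prod x y = (\<not> (fst x \<noteq> fst y), mul (snd x) (snd y))"

text \<open>The index \<open>k\<close> runs over the number of all entries, not of matrices, which
  saves a division by \<open>m * m\<close>; for indices \<open>a\<close>, \<open>b\<close>,
  \<open>c\<close>, \<open>d\<close> below \<open>m\<close>, the surplus values of \<open>k\<close>
  address zero matrices.\<close>

definition summands :: "nat \<Rightarrow> bool list \<Rightarrow> (bool \<times> bool list) list \<Rightarrow> nat \<Rightarrow> nat \<Rightarrow> nat \<Rightarrow> nat \<Rightarrow> (bool \<times> bool list) list" where
  "summands m K es a b c d =
    [(False, if a = b \<and> c = d then K else []),
     (False, if a = c \<and> b = d then K else []),
     (False, if a = d \<and> b = c then K else [])] @
    concat (map (\<lambda>k. [neg_prod (entry_at m es k a b) (entry_at m es k c d),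
                      neg_prod (entry_at m es k a c) (entry_at m es k b d),
                      neg_prod (entry_at m es k a d) (entry_at m es k b c)]) [0..<length es])"

text \<open>Positive and negative contributions are accumulated separately, so that a single
  subtraction at the end suffices.\<close>

definition split_sum :: "(bool \<times> bool list) list \<Rightarrow> bool list \<times> bool list" where
  "split_sum ts = fold (\<lambda>t s. if fst t then (fst s, add (snd t) (snd s)) else (add (snd t) (fst s), snd s)) ts ([], [])"

lemma ptime_split_sum [ptime_intros]:
  assumes "ptime f" shows "ptime (\<lambda>e. split_sum (f e))"
  unfolding split_sum_def
proof (rule ptime_fold[where q = "[:10, 10:]"])
  show "rsize (if fst t then (fst s, add (snd t) (snd s)) else (add (snd t) (fst s), snd s))
      \<le> rsize s + poly [:10, 10:] (rsize (e, t))" for e :: 'a and t :: "bool \<times> bool list" and s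
    by (cases s; cases t) (auto simp: rsize_bools length_add max_def)
qed (intro ptime_intros assms)+

definition signed :: "bool \<times> bool list \<Rightarrow> int" where
  "signed p = (if fst p then - val (snd p) else val (snd p))"

lemma split_sum_correct: "val (fst (split_sum ts)) - val (snd (split_sum ts)) = sum_list (map signed ts)"
proof -
  let ?h = "\<lambda>t s. if fst t then (fst s, add (snd t) (snd s)) else (add (snd t) (fst s), snd s)"
  have "val (fst (fold ?h ts s)) - val (snd (fold ?h ts s)) = val (fst s) - val (snd s) + sum_list (map signed ts)" for s
    by (induction ts arbitrary: s) (auto simp: val_add signed_def)
  from this[of "([], [])"] show ?thesis by (simp add: split_sum_def)
qed

definition write_rat :: "bool list \<times> bool list \<Rightarrow> letter list" where
  "write_rat p = write_int (diff (fst p) (snd p)) @ [Zero, One, Sep]"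

lemma ptime_write_rat [ptime_intros]:
  assumes "ptime f" shows "ptime (\<lambda>e. write_rat (f e))"
proof -
  have "ptime write_rat" unfolding write_rat_def by (intro ptime_intros)
  then show ?thesis by (rule ptime_comp[OF assms])
qed

lemma write_rat_eq: "write_rat p = enc_rat (of_int (val (fst p) - val (snd p)))"
proof -
  have "bits 1 = [One]" by (simp add: bits.simps)
  then show ?thesis
    by (simp add: write_rat_def write_int_diff enc_rat_def enc_int_def[of 1] del: of_int_diff)
qed

text \<open>The last tensor index is outermost because \<open>List.n_lists\<close> varies the first
  position fastest.\<close>

definition all_entries :: "nat \<Rightarrow> bool list \<Rightarrow> (bool \<times> bool list) list \<Rightarrow> letter list" where
  "all_entries m K es = concat (map (\<lambda>d. concat (map (\<lambda>c. concat (map (\<lambda>b. concat (map (\<lambda>a.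
     write_rat (split_sum (summands m K es a b c d))) [0..<m])) [0..<m])) [0..<m])) [0..<m])"

lemma ptime_all_entries [ptime_intros]:
  assumes "ptime m" "ptime K" "ptime es" shows "ptime (\<lambda>e. all_entries (m e) (K e) (es e))"
proof -
  have "ptime (\<lambda>p. all_entries (fst p) (fst (snd p)) (snd (snd p)))"
    unfolding all_entries_def summands_def entry_at_def neg_prod_def by (intro ptime_intros)
  then show ?thesis using assms by (rule ptime_lift3)
qed

text \<open>The dimension is the length of the first token. \<open>K\<close> is written as
  \<open>8 * length w\<close> zero digits below a one, and the threshold \<open>3 * K\<close> as the
  same zeros below two ones.\<close>

definition reduction_word :: "letter list \<Rightarrow> letter list" where
  "reduction_word w =
    replicate (length (first [] (toks w))) One @ [Sep] @
    all_entries (length (first [] (toks w))) (replicate (8 * length w) False @ [True])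
      (cleared_list (pairs (tl (toks w)))) @
    write_rat (replicate (8 * length w) False @ [True, True], [])"

lemma ptime_reduction_word: "ptime reduction_word"
  unfolding reduction_word_def by (intro ptime_intros)

lemma concat_map_n_lists:
  "concat (map g (List.n_lists (Suc n) xs)) =
    concat (map (\<lambda>ys. concat (map (\<lambda>y. g (y # ys)) xs)) (List.n_lists n xs))"
proof -
  have "concat (map g (concat (map (\<lambda>ys. map (\<lambda>y. y # ys) xs) yss))) =
      concat (map (\<lambda>ys. concat (map (\<lambda>y. g (y # ys)) xs)) yss)" for yss
    by (induction yss) (auto simp: comp_def)
  then show ?thesis by simp
qed

lemma all_entries_eq:
  "all_entries m K es = concat (map (\<lambda>is. write_rat (split_sum
     (summands m K es (is ! 0) (is ! 1) (is ! 2) (is ! 3)))) (List.n_lists 4 [0..<m]))"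
  by (simp add: all_entries_def numeral_eq_Suc concat_map_n_lists del: List.n_lists.simps(2))

section \<open>The quartic form of the reduction\<close>

lemma sum_indices_Suc:
  "(\<Sum>is \<in> indices (Suc d) n. g is) = (\<Sum>i<n. \<Sum>is \<in> indices d n. g (i # is))"
proof -
  have "indices (Suc d) n = (\<lambda>(i, is). i # is) ` ({..<n} \<times> indices d n)"
    by (force simp: indices_def length_Suc_conv image_iff)
  moreover have "inj_on (\<lambda>(i, is). i # is) ({..<n} \<times> indices d n)"
    by (auto simp: inj_on_def)
  ultimately show ?thesis
    by (simp add: sum.reindex sum.cartesian_product case_prod_unfold)
qed

lemma indices_0: "indices 0 n = {[]}"
  by (auto simp: indices_def)

definition quad_sum :: "nat \<Rightarrow> (nat \<Rightarrow> nat \<Rightarrow> nat \<Rightarrow> nat \<Rightarrow> real) \<Rightarrow> real" where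
  "quad_sum m g = (\<Sum>a<m. \<Sum>b<m. \<Sum>c<m. \<Sum>d<m. g a b c d)"

lemma tensor_form_4:
  "tensor_form 4 m T x = quad_sum m (\<lambda>a b c d. T [a, b, c, d] * (x $ a * x $ b * x $ c * x $ d))"
  unfolding tensor_form_def quad_sum_def
  by (simp add: numeral_eq_Suc sum_indices_Suc indices_0 mult.assoc)

lemma quad_sum_swap23: "quad_sum m (\<lambda>a b c d. g a c b d) = quad_sum m g"
  unfolding quad_sum_def by (rule sum.cong[OF refl], rule sum.swap)

lemma quad_sum_swap34: "quad_sum m (\<lambda>a b c d. g a b d c) = quad_sum m g"
  unfolding quad_sum_def by (rule sum.cong[OF refl], rule sum.cong[OF refl], rule sum.swap)

lemma quad_sum_product:
  "quad_sum m (\<lambda>a b c d. f a b * g c d) = (\<Sum>a<m. \<Sum>b<m. f a b) * (\<Sum>c<m. \<Sum>d<m. g c d)"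
  unfolding quad_sum_def by (simp only: sum_distrib_right) (simp only: sum_distrib_left)

definition qform :: "nat \<Rightarrow> (nat \<Rightarrow> nat \<Rightarrow> real) \<Rightarrow> (nat \<Rightarrow> real) \<Rightarrow> real" where
  "qform m M x = (\<Sum>i<m. \<Sum>j<m. M i j * (x i * x j))"

text \<open>The sum over the three splittings of four positions into pairs; for symmetric
  \<open>M\<close> it is three times the symmetrisation of the tensor square of \<open>M\<close>,
  and it needs no division.\<close>

definition sym_square :: "(nat \<Rightarrow> nat \<Rightarrow> 'a::comm_ring_1) \<Rightarrow> nat \<Rightarrow> nat \<Rightarrow> nat \<Rightarrow> nat \<Rightarrow> 'a" where
  "sym_square M a b c d = M a b * M c d + M a c * M b d + M a d * M b c"

lemma quad_sum_add: "quad_sum m (\<lambda>a b c d. f a b c d + g a b c d) = quad_sum m f + quad_sum m g"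
  by (simp add: quad_sum_def sum.distrib)

lemma quad_sum_diff: "quad_sum m (\<lambda>a b c d. f a b c d - g a b c d) = quad_sum m f - quad_sum m g"
  by (simp add: quad_sum_def sum_subtractf)

lemma quad_sum_cmult: "quad_sum m (\<lambda>a b c d. r * f a b c d) = r * quad_sum m f"
  by (simp add: quad_sum_def sum_distrib_left)

lemma quad_sum_sum: "quad_sum m (\<lambda>a b c d. \<Sum>k<(R::nat). f k a b c d) = (\<Sum>k<R. quad_sum m (f k))"
  by (induction R) (simp_all add: quad_sum_add, simp add: quad_sum_def)

text \<open>Renaming the summation indices turns each of the three pairings into the first
  one.\<close>

lemma quad_sum_sym_square:
  "quad_sum m (\<lambda>a b c d. sym_square M a b c d * (x a * x b * x c * x d)) = 3 * (qform m M x)\<^sup>2"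
proof -
  let ?h = "\<lambda>a b c d. (M a b * (x a * x b)) * (M c d * (x c * x d))"
  have 1: "quad_sum m ?h = (qform m M x)\<^sup>2"
    unfolding quad_sum_product by (simp add: qform_def power2_eq_square)
  have "quad_sum m (\<lambda>a b c d. sym_square M a b c d * (x a * x b * x c * x d)) =
      quad_sum m (\<lambda>a b c d. ?h a b c d + ?h a c b d + ?h a d b c)"
    by (simp add: sym_square_def algebra_simps)
  also have "\<dots> = quad_sum m ?h + quad_sum m (\<lambda>a b c d. ?h a c b d) + quad_sum m (\<lambda>a b c d. ?h a d b c)"
    unfolding quad_sum_add ..
  also have "quad_sum m (\<lambda>a b c d. ?h a c b d) = quad_sum m ?h"
    by (rule quad_sum_swap23)
  also have "quad_sum m (\<lambda>a b c d. ?h a d b c) = quad_sum m (\<lambda>a b c d. ?h a c b d)"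
    using quad_sum_swap34[of m "\<lambda>a b c d. ?h a c b d"] .
  also have "\<dots> = quad_sum m ?h"
    by (rule quad_sum_swap23)
  finally show ?thesis using 1 by simp
qed

definition reduction_tensor :: "'a \<Rightarrow> nat \<Rightarrow> (nat \<Rightarrow> nat \<Rightarrow> nat \<Rightarrow> 'a) \<Rightarrow> nat list \<Rightarrow> 'a::comm_ring_1" where
  "reduction_tensor K R E is =
    K * sym_square (\<lambda>i j. of_bool (i = j)) (is ! 0) (is ! 1) (is ! 2) (is ! 3)
    - (\<Sum>k<R. sym_square (E k) (is ! 0) (is ! 1) (is ! 2) (is ! 3))"

text \<open>A permutation of the indices permutes the three pairings and swaps arguments of
  \<open>M\<close>. Symmetry is assumed just for the pairs that occur, as the matrices are
  controlled only below \<open>m\<close>. The proof peels elements off the multisets to list all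
  arrangements.\<close>

lemma sym_square_perm:
  assumes "M b a = M a b" "M c a = M a c" "M d a = M a d" "M c b = M b c" "M d b = M b d" "M d c = M c d"
    and "mset [a, b, c, d] = mset [a', b', c', d']"
  shows "sym_square M a b c d = sym_square M a' b' c' d'"
proof -
  have rest: "mset (remove1 x ys) = mset xs" if "mset ys = mset (x # xs)" for x :: nat and xs ys
    using that by (simp add: mset_remove1)
  have mem: "x \<in> set ys" if "mset ys = mset (x # xs)" for x :: nat and xs ys
    using mset_eq_setD[OF that] by simp
  have 2: "u' = u \<and> v' = v \<or> u' = v \<and> v' = u" if "mset [u, v] = mset [u', v']" for u v u' v' :: nat
    using rest[OF that] mem[OF that] by (auto split: if_splits)
  have triple: "(u' = u \<and> (v' = v \<and> w' = w \<or> v' = w \<and> w' = v)) \<or> (u' = v \<and> (v' = u \<and> w' = w \<or> v' = w \<and> w' = u))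
     \<or> (u' = w \<and> (v' = u \<and> w' = v \<or> v' = v \<and> w' = u))"
    if h: "mset [u, v, w] = mset [u', v', w']" for u v w u' v' w' :: nat
  proof -
    have "u' = u \<or> u' = v \<or> u' = w" using mem[OF h] by auto
    moreover have "mset [u, w] = mset [v', w']" if "u' = v"
      using rest[OF h] that by (cases "u = v") (simp_all add: add_mset_commute)
    moreover have "mset [u, v] = mset [v', w']" if "u' = w"
      using rest[OF h] that by (cases "u = w"; cases "v = w") (simp_all add: add_mset_commute)
    moreover have "mset [v, w] = mset [v', w']" if "u' = u"
      using rest[OF h] that by simp
    ultimately
    consider "u' = u" "mset [v, w] = mset [v', w']" | "u' = v" "mset [u, w] = mset [v', w']"
      | "u' = w" "mset [u, v] = mset [v', w']"
      by blast
    then show ?thesis by cases (use 2 in blast)+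
  qed
  have "a' = a \<or> a' = b \<or> a' = c \<or> a' = d" using mem[OF assms(7)] by auto
  moreover have "mset [b, c, d] = mset [b', c', d']" if "a' = a"
    using rest[OF assms(7)] that by simp
  moreover have "mset [a, c, d] = mset [b', c', d']" if "a' = b"
    using rest[OF assms(7)] that by (cases "a = b") (simp_all add: add_mset_commute)
  moreover have "mset [a, b, d] = mset [b', c', d']" if "a' = c"
    using rest[OF assms(7)] that by (cases "a = c"; cases "b = c") (simp_all add: add_mset_commute)
  moreover have "mset [a, b, c] = mset [b', c', d']" if "a' = d"
    using rest[OF assms(7)] that by (cases "a = d"; cases "b = d"; cases "c = d") (simp_all add: add_mset_commute)
  ultimately consider "a' = a" "mset [b, c, d] = mset [b', c', d']" | "a' = b" "mset [a, c, d] = mset [b', c', d']"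
    | "a' = c" "mset [a, b, d] = mset [b', c', d']" | "a' = d" "mset [a, b, c] = mset [b', c', d']"
    by blast
  then show ?thesis
  proof cases
    case 1
    with triple[OF 1(2)] assms(1-6) show ?thesis by (auto simp: sym_square_def)
  next
    case 2
    with triple[OF 2(2)] assms(1-6) show ?thesis by (auto simp: sym_square_def)
  next
    case 3
    with triple[OF 3(2)] assms(1-6) show ?thesis by (auto simp: sym_square_def)
  next
    case 4
    with triple[OF 4(2)] assms(1-6) show ?thesis by (auto simp: sym_square_def)
  qed
qed

lemma symmetric_reduction_tensor:
  assumes sym: "\<And>k i j. k < R \<Longrightarrow> i < m \<Longrightarrow> j < m \<Longrightarrow> E k i j = E k j i"
  shows "symmetric_tensor 4 m (reduction_tensor K R E)"
  unfolding symmetric_tensor_def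
proof (intro ballI impI)
  fix "is" js assume "is": "is \<in> indices 4 m" and js: "js \<in> indices 4 m" and eq: "mset is = mset js"
  obtain a b c d where 1: "is = [a, b, c, d]" "a < m" "b < m" "c < m" "d < m"
    using "is" by (auto simp: indices_def numeral_eq_Suc length_Suc_conv)
  obtain a' b' c' d' where 2: "js = [a', b', c', d']"
    using js by (auto simp: indices_def numeral_eq_Suc length_Suc_conv)
  have perm: "mset [a, b, c, d] = mset [a', b', c', d']" using eq 1 2 by simp
  have "sym_square (E k) a b c d = sym_square (E k) a' b' c' d'" if "k < R" for k
    using 1 sym that by (intro sym_square_perm perm) auto
  moreover have "sym_square (\<lambda>i j. of_bool (i = j)) a b c d = (sym_square (\<lambda>i j. of_bool (i = j)) a' b' c' d' :: 'a)"
    by (intro sym_square_perm perm) auto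
  ultimately show "reduction_tensor K R E is = reduction_tensor K R E js"
    by (auto simp: reduction_tensor_def 1 2 intro!: sum.cong)
qed

lemma tensor_form_reduction_tensor:
  "tensor_form 4 m (reduction_tensor K R E) x =
    3 * K * (\<Sum>i<m. (x $ i)\<^sup>2)\<^sup>2 - 3 * (\<Sum>k<R. (qform m (E k) (\<lambda>i. x $ i))\<^sup>2)"
proof -
  let ?w = "\<lambda>a b c d. x $ a * x $ b * x $ c * x $ d"
  have "tensor_form 4 m (reduction_tensor K R E) x =
      K * quad_sum m (\<lambda>a b c d. sym_square (\<lambda>i j. of_bool (i = j)) a b c d * ?w a b c d)
      - (\<Sum>k<R. quad_sum m (\<lambda>a b c d. sym_square (E k) a b c d * ?w a b c d))"
    unfolding tensor_form_4 quad_sum_sum[symmetric] quad_sum_cmult[symmetric] quad_sum_diff[symmetric]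
    by (simp add: reduction_tensor_def left_diff_distrib sum_distrib_right mult.assoc numeral_3_eq_3 numeral_2_eq_2)
  moreover have "qform m (\<lambda>i j. of_bool (i = j)) (\<lambda>i. x $ i) = (\<Sum>i<m. (x $ i)\<^sup>2)"
  proof -
    have "(\<Sum>j<m. of_bool (i = j) * (x $ i * x $ j)) = (x $ i)\<^sup>2" if "i < m" for i
    proof -
      have "(\<Sum>j<m. of_bool (i = j) * (x $ i * x $ j)) = (\<Sum>j<m. if i = j then x $ i * x $ j else 0)"
        by (rule sum.cong) auto
      then show ?thesis using that by (simp add: power2_eq_square)
    qed
    then show ?thesis by (simp add: qform_def)
  qed
  ultimately show ?thesis
    by (simp add: quad_sum_sym_square sum_distrib_left)
qed

section \<open>Compactness and the spectral norm\<close>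

text \<open>Vectors extended by zero live in the product space of functions, where the sphere is a
  closed subset of a product of compact sets.\<close>

lemma compact_sphere:
  "compact {x :: nat \<Rightarrow> real. (\<forall>i \<ge> m. x i = 0) \<and> (\<Sum>i<m. (x i)\<^sup>2) = 1}"
proof -
  let ?B = "PiE UNIV (\<lambda>i. if i < m then {- 1..1 :: real} else {0})"
  have "compact ?B"
    unfolding compactin_euclidean_iff[symmetric] euclidean_product_topology[symmetric] compactin_PiE
    by (auto simp: compactin_euclidean_iff)
  moreover have "closed {x :: nat \<Rightarrow> real. (\<Sum>i<m. (x i)\<^sup>2) = 1}"
    by (intro closed_Collect_eq continuous_intros continuous_on_product_coordinates)
  ultimately have "compact (?B \<inter> {x. (\<Sum>i<m. (x i)\<^sup>2) = 1})"
    by (rule compact_Int_closed)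
  moreover have "?B \<inter> {x. (\<Sum>i<m. (x i)\<^sup>2) = 1} = {x. (\<forall>i \<ge> m. x i = 0) \<and> (\<Sum>i<m. (x i)\<^sup>2) = 1}"
  proof -
    have "- 1 \<le> x i \<and> x i \<le> 1" if "(\<Sum>i<m. (x i)\<^sup>2) = 1" "i < m" for x :: "nat \<Rightarrow> real" and i
    proof -
      have "(x i)\<^sup>2 \<le> (\<Sum>i<m. (x i)\<^sup>2)"
        using that(2) by (intro member_le_sum) auto
      then show ?thesis using that(1) abs_square_le_1[of "x i"] by auto
    qed
    then show ?thesis by (auto simp: PiE_def Pi_iff split: if_splits)
  qed
  ultimately show ?thesis by simp
qed

lemma vnorm_eq_1_iff:
  assumes "x \<in> carrier_vec m" shows "vnorm x = 1 \<longleftrightarrow> (\<Sum>i<m. (x $ i)\<^sup>2) = 1"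
proof -
  have "x \<bullet> x = (\<Sum>i<m. (x $ i)\<^sup>2)"
    using assms by (auto simp: scalar_prod_def power2_eq_square atLeast0LessThan)
  then show ?thesis by (simp add: vnorm_def)
qed

theorem sym_op_norm_reduction_tensor:
  assumes "m \<ge> 1"
    and K: "\<And>x. (\<Sum>i<m. (x i)\<^sup>2) = 1 \<Longrightarrow> (\<Sum>k<R. (qform m (E k) x)\<^sup>2) \<le> K"
  shows "sym_op_norm 4 m (reduction_tensor K R E) \<ge> 3 * K \<longleftrightarrow>
    (\<exists>z \<in> carrier_vec m. vnorm z = 1 \<and> (\<forall>k<R. qform m (E k) (\<lambda>i. z $ i) = 0))"
proof -
  define S where "S x = (\<Sum>k<R. (qform m (E k) x)\<^sup>2)" for x
  define U where "U = {x \<in> carrier_vec m. vnorm x = 1}"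
  have S_nonneg: "S x \<ge> 0" for x by (simp add: S_def sum_nonneg)
  \<comment> \<open>Allows passing between a vector, its extension by zero, and the vector cut out
    of a function.\<close>
  have S_cong: "S x = S y" if "\<And>i. i < m \<Longrightarrow> x i = y i" for x y
    unfolding S_def qform_def using that
    by (intro sum.cong refl arg_cong[where f = "\<lambda>t. t\<^sup>2"]) auto
  have form: "\<bar>tensor_form 4 m (reduction_tensor K R E) x\<bar> = 3 * K - 3 * S (\<lambda>i. x $ i)" if "x \<in> U" for x
  proof -
    have 1: "(\<Sum>i<m. (x $ i)\<^sup>2) = 1" using that vnorm_eq_1_iff by (auto simp: U_def)
    then show ?thesis
      using K[OF 1] by (simp add: tensor_form_reduction_tensor S_def)
  qed
  have norm: "sym_op_norm 4 m (reduction_tensor K R E) = (SUP x \<in> U. 3 * K - 3 * S (\<lambda>i. x $ i))"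
    unfolding sym_op_norm_def U_def[symmetric] by (rule SUP_cong) (auto simp: form)
  have vec: "vec m x \<in> U" if "(\<Sum>i<m. (x i)\<^sup>2) = 1" for x :: "nat \<Rightarrow> real"
    using that vnorm_eq_1_iff[of "vec m x" m] by (simp add: U_def)
  have "U \<noteq> {}"
  proof -
    \<comment> \<open>The first unit vector, which exists because \<open>m \<ge> 1\<close>.\<close>
    have "(\<Sum>i<m. (of_bool (i = 0) :: real)\<^sup>2) = 1"
      using \<open>m \<ge> 1\<close> by (simp add: of_bool_def if_distrib[of "\<lambda>t. t\<^sup>2"] cong: if_cong)
    from vec[OF this] show ?thesis by blast
  qed
  show ?thesis
  proof
    assume *: "sym_op_norm 4 m (reduction_tensor K R E) \<ge> 3 * K"
    let ?C = "{x :: nat \<Rightarrow> real. (\<forall>i \<ge> m. x i = 0) \<and> (\<Sum>i<m. (x i)\<^sup>2) = 1}"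
    let ?ext = "\<lambda>x :: real vec. \<lambda>i. if i < m then x $ i else 0"
    have ext_in: "?ext x \<in> ?C" if "x \<in> U" for x
      using that vnorm_eq_1_iff[of x m] by (simp add: U_def)
    obtain u where "u \<in> U" using \<open>U \<noteq> {}\<close> by auto
    have "?C \<noteq> {}"
      using ext_in[OF \<open>u \<in> U\<close>] by (metis (no_types, lifting) empty_iff)
    have cont: "continuous_on ?C S"
      unfolding S_def qform_def
      by (intro continuous_intros continuous_on_subset[OF continuous_on_product_coordinates]) auto
    \<comment> \<open>A minimiser of \<open>S\<close> on the sphere bounds the norm by
      \<open>3 * K - 3 * S y\<close>; the threshold then forces \<open>S y = 0\<close>.\<close>
    obtain y where y: "y \<in> ?C" and y_min: "\<forall>x \<in> ?C. S y \<le> S x"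
      using continuous_attains_inf[OF compact_sphere \<open>?C \<noteq> {}\<close> cont] by (rule bexE)
    have "sym_op_norm 4 m (reduction_tensor K R E) \<le> 3 * K - 3 * S y"
      unfolding norm
    proof (rule cSUP_least[OF \<open>U \<noteq> {}\<close>])
      fix x assume "x \<in> U"
      then have "S y \<le> S (?ext x)" by (intro bspec[OF y_min] ext_in)
      also have "\<dots> = S (\<lambda>i. x $ i)" by (rule S_cong) simp
      finally show "3 * K - 3 * S (\<lambda>i. x $ i) \<le> 3 * K - 3 * S y" by simp
    qed
    then have "S y = 0" using * S_nonneg[of y] by simp
    then have "S (\<lambda>i. vec m y $ i) = 0" using S_cong[of "\<lambda>i. vec m y $ i" y] by simp
    then have "\<forall>k<R. qform m (E k) (\<lambda>i. vec m y $ i) = 0"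
      unfolding S_def by (subst (asm) sum_nonneg_eq_0_iff) auto
    moreover have "vec m y \<in> U" using y by (intro vec) simp
    ultimately show "\<exists>z \<in> carrier_vec m. vnorm z = 1 \<and> (\<forall>k<R. qform m (E k) (\<lambda>i. z $ i) = 0)"
      unfolding U_def by blast
  next
    assume "\<exists>z \<in> carrier_vec m. vnorm z = 1 \<and> (\<forall>k<R. qform m (E k) (\<lambda>i. z $ i) = 0)"
    then obtain z where z: "z \<in> U" "\<forall>k<R. qform m (E k) (\<lambda>i. z $ i) = 0"
      by (auto simp: U_def)
    have "3 * K - 3 * S (\<lambda>i. z $ i) \<le> sym_op_norm 4 m (reduction_tensor K R E)"
      unfolding norm
    proof (rule cSUP_upper[OF z(1)])
      show "bdd_above ((\<lambda>x. 3 * K - 3 * S (\<lambda>i. x $ i)) ` U)"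
        using S_nonneg by (intro bdd_aboveI[of _ "3 * K"]) auto
    qed
    then show "3 * K \<le> sym_op_norm 4 m (reduction_tensor K R E)"
      using z(2) by (simp add: S_def)
  qed
qed

text \<open>Coordinates of a unit vector are at most 1 in absolute value, so each form is a sum of
  \<open>m * m\<close> terms bounded by \<open>B\<close>.\<close>

lemma sum_qform_squares_le:
  assumes "\<And>k i j. k < R \<Longrightarrow> i < m \<Longrightarrow> j < m \<Longrightarrow> \<bar>E k i j\<bar> \<le> B" and "(\<Sum>i<m. (x i)\<^sup>2) = 1" and "B \<ge> 0"
  shows "(\<Sum>k<R. (qform m (E k) x)\<^sup>2) \<le> real R * (real m * real m * B)\<^sup>2"
proof -
  have x: "\<bar>x i\<bar> \<le> 1" if "i < m" for i
  proof -
    have "(x i)\<^sup>2 \<le> (\<Sum>i<m. (x i)\<^sup>2)"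
      using that by (intro member_le_sum) auto
    then show ?thesis using assms(2) abs_square_le_1[of "x i"] by auto
  qed
  have "\<bar>qform m (E k) x\<bar> \<le> real m * real m * B" if "k < R" for k
  proof -
    have "\<bar>E k i j * (x i * x j)\<bar> \<le> B" if "i < m" "j < m" for i j
      using mult_mono[OF assms(1)[OF \<open>k < R\<close> that] mult_mono[OF x[OF that(1)] x[OF that(2)]]] assms(3)
      by (simp add: abs_mult)
    then have row: "(\<Sum>j<m. \<bar>E k i j * (x i * x j)\<bar>) \<le> real m * B" if "i < m" for i
      using that sum_mono[of "{..<m}" "\<lambda>j. \<bar>E k i j * (x i * x j)\<bar>" "\<lambda>_. B"] by simp
    have "\<bar>qform m (E k) x\<bar> \<le> (\<Sum>i<m. \<Sum>j<m. \<bar>E k i j * (x i * x j)\<bar>)"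
      unfolding qform_def by (rule order_trans[OF sum_abs]) (rule sum_mono, rule sum_abs)
    also have "\<dots> \<le> (\<Sum>i<m. real m * B)"
      by (rule sum_mono) (use row in simp)
    finally have "\<bar>qform m (E k) x\<bar> \<le> (\<Sum>i<m. real m * B)" .
    then show ?thesis by simp
  qed
  then have "(qform m (E k) x)\<^sup>2 \<le> (real m * real m * B)\<^sup>2" if "k < R" for k
    using that assms(3) by (intro abs_le_square_iff[THEN iffD1]) auto
  then show ?thesis
    using sum_mono[of "{..<R}" "\<lambda>k. (qform m (E k) x)\<^sup>2" "\<lambda>_. (real m * real m * B)\<^sup>2"] by simp
qed

section \<open>Correctness of the reduction\<close>

definition flat_entries :: "nat \<Rightarrow> rat mat list \<Rightarrow> rat list" where
  "flat_entries m Qs = concat (map (\<lambda>Q. concat (map (\<lambda>i. map (\<lambda>j. Q $$ (i, j)) [0..<m]) [0..<m])) Qs)"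

lemma encode_HQSF: "encode HQSF (m, Qs) = enc_dim m @ concat (map enc_rat (flat_entries m Qs))"
proof -
  have *: "concat (concat (map (\<lambda>i. map (\<lambda>j. enc_rat (Q $$ (i, j))) [0..<m]) is)) =
      concat (map enc_rat (concat (map (\<lambda>i. map (\<lambda>j. Q $$ (i, j)) [0..<m]) is)))" for Q and "is" :: "nat list"
    by (induction "is") (auto simp: comp_def)
  have "concat (map (\<lambda>Q. concat (concat (map (\<lambda>i. map (\<lambda>j. enc_rat (Q $$ (i, j))) [0..<m]) [0..<m]))) Qs) =
      concat (map enc_rat (flat_entries m Qs))"
    unfolding flat_entries_def * by (induction Qs) auto
  then show ?thesis by (simp add: HQSF_def)
qed

definition num_token :: "rat \<Rightarrow> letter list" where
  "num_token q = (if fst (quotient_of q) < 0 then One else Zero) # bits (nat \<bar>fst (quotient_of q)\<bar>)"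

definition den_token :: "rat \<Rightarrow> letter list" where
  "den_token q = Zero # bits (nat (snd (quotient_of q)))"

lemma enc_rat_tokens: "enc_rat q = num_token q @ Sep # den_token q @ [Sep]"
  using quotient_of_denom_pos'[of q]
  by (simp add: enc_rat_def enc_int_def num_token_def den_token_def)

lemma Sep_notin_bits: "Sep \<notin> set (bits n)"
proof (induction n rule: bits.induct)
  case (1 n)
  then show ?case by (subst bits.simps) auto
qed

lemma toks_entries: "toks (concat (map enc_rat qs)) = concat (map (\<lambda>q. [num_token q, den_token q]) qs)"
proof (induction qs)
  case (Cons q qs)
  have "Sep \<notin> set (num_token q)" "Sep \<notin> set (den_token q)"
    using Sep_notin_bits by (auto simp: num_token_def den_token_def)
  with Cons show ?case by (simp add: enc_rat_tokens toks_token)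
qed (simp add: toks_def)

lemma toks_encode:
  "toks (encode HQSF (m, Qs)) =
    replicate m One # concat (map (\<lambda>q. [num_token q, den_token q]) (flat_entries m Qs))"
proof -
  have "toks (replicate m One @ Sep # w) = replicate m One # toks w" for w
    by (rule toks_token) simp
  then show ?thesis by (simp add: encode_HQSF enc_dim_def toks_entries)
qed

abbreviation token_pairs :: "rat list \<Rightarrow> (letter list \<times> letter list) list" where
  "token_pairs qs \<equiv> map (\<lambda>q. (num_token q, den_token q)) qs"

lemma prod_list_val_le: "prod_list (map val xss) \<le> 2 ^ sum_list (map length xss)"
proof (induction xss)
  case (Cons xs xss)
  have "0 \<le> prod_list (map val xss)"
    by (induction xss) (auto simp: val_nonneg)
  then have "val xs * prod_list (map val xss) \<le> 2 ^ length xs * 2 ^ sum_list (map length xss)"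
    using Cons val_less[of xs] val_nonneg
    by (intro mult_mono) auto
  then show ?case by (simp add: power_add)
qed simp

lemma val_num_token: "val (magnitude (num_token q)) = \<bar>fst (quotient_of q)\<bar>"
  and val_den_token: "val (magnitude (den_token q)) = snd (quotient_of q)"
  using quotient_of_denom_pos'[of q] by (simp_all add: magnitude_def num_token_def den_token_def val_bits)

definition common_denominator :: "rat list \<Rightarrow> int" where
  "common_denominator qs = (\<Prod>q<length qs. snd (quotient_of (qs ! q)))"

lemma common_denominator_pos: "common_denominator qs > 0"
  unfolding common_denominator_def by (rule prod_pos) (simp add: quotient_of_denom_pos')

text \<open>Replacing the factor \<open>d p\<close> of the common denominator by the numerator
  \<open>n p\<close> multiplies it by \<open>n p / d p\<close>, the entry itself.\<close>

lemma signed_cleared: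
  assumes "p < length qs"
  shows "real_of_int (signed (cleared (token_pairs qs) p)) = real_of_int (common_denominator qs) * of_rat (qs ! p)"
proof -
  define n d where "n q = fst (quotient_of (qs ! q))" and "d q = snd (quotient_of (qs ! q))" for q
  let ?A = "{..<length qs}"
  have "val (snd (cleared (token_pairs qs) p)) =
      prod_list (map (\<lambda>q. val (magnitude (if q = p then fst (lookup ([], []) (token_pairs qs) q)
        else snd (lookup ([], []) (token_pairs qs) q)))) [0..<length qs])"
    by (simp add: cleared_def val_mul_all comp_def)
  also have "map (\<lambda>q. val (magnitude (if q = p then fst (lookup ([], []) (token_pairs qs) q)
        else snd (lookup ([], []) (token_pairs qs) q)))) [0..<length qs] =
      map (\<lambda>q. if q = p then \<bar>n q\<bar> else d q) [0..<length qs]"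
    by (rule map_cong) (auto simp: lookup_eq val_num_token val_den_token n_def d_def)
  also have "prod_list (map (\<lambda>q. if q = p then \<bar>n q\<bar> else d q) [0..<length qs]) = (\<Prod>q\<in>?A. if q = p then \<bar>n q\<bar> else d q)"
    by (simp add: atLeast0LessThan flip: prod.distinct_set_conv_list)
  also have "\<dots> = \<bar>n p\<bar> * (\<Prod>q\<in>?A - {p}. d q)"
    using assms by (subst prod.remove[of _ p]) (auto intro!: prod.cong)
  finally have "signed (cleared (token_pairs qs) p) = n p * (\<Prod>q\<in>?A - {p}. d q)"
    using assms
    by (auto simp: signed_def cleared_def lookup_eq num_token_def n_def split: if_splits)
  moreover have "common_denominator qs = d p * (\<Prod>q\<in>?A - {p}. d q)"
    unfolding common_denominator_def d_def using assms by (subst prod.remove[of _ p]) auto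
  moreover have "(of_rat (qs ! p) :: real) = of_int (n p) / of_int (d p)"
    using quotient_of_div[of "qs ! p" "n p" "d p"] unfolding n_def d_def
    by (metis of_rat_divide of_rat_of_int_eq prod.collapse)
  moreover have "d p > 0" by (simp add: d_def quotient_of_denom_pos')
  ultimately show ?thesis by simp
qed

lemma length_encode_HQSF:
  "length (encode HQSF (m, Qs)) =
    Suc m + sum_list (map (\<lambda>q. length (num_token q) + length (den_token q) + 2) (flat_entries m Qs))"
  by (simp add: encode_HQSF enc_dim_def length_concat comp_def enc_rat_tokens)

text \<open>Each entry contributes one of its two tokens as a factor, so the digits of all factors
  together are at most the letters of the entries.\<close>

lemma abs_signed_cleared_le:
  "\<bar>signed (cleared (token_pairs qs) p)\<bar> \<le> 2 ^ sum_list (map (\<lambda>q. length (num_token q) + length (den_token q) + 2) qs)"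
proof -
  let ?xss = "map (\<lambda>q. magnitude (if q = p then fst (lookup ([], []) (token_pairs qs) q)
        else snd (lookup ([], []) (token_pairs qs) q))) [0..<length qs]"
  have "sum_list (map length ?xss) \<le>
      sum_list (map (\<lambda>q. length (num_token (qs ! q)) + length (den_token (qs ! q)) + 2) [0..<length qs])"
    unfolding map_map by (rule sum_list_mono) (auto simp: lookup_eq magnitude_def)
  also have "map (\<lambda>q. length (num_token (qs ! q)) + length (den_token (qs ! q)) + 2) [0..<length qs] =
      map (\<lambda>q. length (num_token q) + length (den_token q) + 2) qs"
    by (rule nth_equalityI) auto
  finally have "(2 :: int) ^ sum_list (map length ?xss) \<le>
      2 ^ sum_list (map (\<lambda>q. length (num_token q) + length (den_token q) + 2) qs)"
    by (intro power_increasing) auto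
  moreover have "\<bar>signed (cleared (token_pairs qs) p)\<bar> = prod_list (map val ?xss)"
    using val_nonneg[of "mul_all ?xss"] by (simp add: signed_def cleared_def val_mul_all)
  ultimately show ?thesis using prod_list_val_le[of ?xss] by linarith
qed

lemma nth_concat_blocks:
  assumes "\<And>x. x \<in> set xs \<Longrightarrow> length (f x) = L" "k < length xs" "t < L"
  shows "concat (map f xs) ! (k * L + t) = f (xs ! k) ! t"
  using assms
proof (induction xs arbitrary: k)
  case (Cons x xs)
  then show ?case
    by (cases k) (auto simp: nth_append)
qed simp

lemma length_concat_blocks:
  "(\<And>x. x \<in> set xs \<Longrightarrow> length (f x) = L) \<Longrightarrow> length (concat (map f xs)) = length xs * L"
  by (induction xs) auto

lemma length_flat_entries: "length (flat_entries m Qs) = length Qs * (m * m)"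
  unfolding flat_entries_def by (intro length_concat_blocks) (simp add: length_concat_blocks)

lemma nth_flat_entries:
  assumes "k < length Qs" "i < m" "j < m"
  shows "flat_entries m Qs ! (k * m * m + i * m + j) = Qs ! k $$ (i, j)"
proof -
  have "i * m + j < m * m"
    using assms(2,3) by (metis add.commute less_le_trans mult_Suc mult_le_mono1 nat_add_left_cancel_less Suc_leI)
  then have "flat_entries m Qs ! (k * (m * m) + (i * m + j)) =
      concat (map (\<lambda>i. map (\<lambda>j. Qs ! k $$ (i, j)) [0..<m]) [0..<m]) ! (i * m + j)"
    unfolding flat_entries_def
    by (subst nth_concat_blocks[where L = "m * m"]) (use assms in \<open>auto simp: length_concat_blocks\<close>)
  also have "\<dots> = Qs ! k $$ (i, j)"
    by (subst nth_concat_blocks[where L = m]) (use assms in auto)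
  finally show ?thesis by (simp add: mult.assoc add.assoc)
qed

lemma signed_neg_prod: "signed (neg_prod x y) = - (signed x * signed y)"
  by (auto simp: signed_def neg_prod_def val_mul)

lemma signed_summands:
  "sum_list (map signed (summands m K es (is ! 0) (is ! 1) (is ! 2) (is ! 3))) =
    reduction_tensor (val K) (length es) (\<lambda>k i j. signed (entry_at m es k i j)) is"
proof -
  have *: "sum_list (map signed (concat (map (\<lambda>k. [f k, g k, h k]) ks))) =
      sum_list (map (\<lambda>k. signed (f k) + signed (g k) + signed (h k)) ks)" for f g h and ks :: "nat list"
    by (induction ks) auto
  have delta: "signed (False, if b then K else []) = val K * of_bool b" for b
    by (simp add: signed_def)
  have "sum_list (map signed [(False, if a = b \<and> c = d then K else []), (False, if a = c \<and> b = d then K else []),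
      (False, if a = d \<and> b = c then K else [])]) = val K * sym_square (\<lambda>i j. of_bool (i = j)) a b c d"
    for a b c d :: nat
    by (simp add: delta sym_square_def of_bool_conj distrib_left split del: split_of_bool)
  moreover have "sum_list (map (\<lambda>k. signed (neg_prod (f k a b) (f k c d)) + signed (neg_prod (f k a c) (f k b d))
      + signed (neg_prod (f k a d) (f k b c))) [0..<R]) = - (\<Sum>k<R. sym_square (\<lambda>i j. signed (f k i j)) a b c d)"
    for a b c d R and f :: "nat \<Rightarrow> nat \<Rightarrow> nat \<Rightarrow> bool \<times> bool list"
    by (induction R) (auto simp: signed_neg_prod sym_square_def)
  ultimately show ?thesis
    unfolding summands_def map_append sum_list_append * reduction_tensor_def by simp
qed

lemma of_int_reduction_tensor:
  "of_int (reduction_tensor K R E is) = reduction_tensor (of_int K) R (\<lambda>k i j. of_int (E k i j)) is"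
  by (simp add: reduction_tensor_def sym_square_def split del: split_of_bool)

section \<open>The reduction on instances\<close>

text \<open>Defined through the word-level computation, so that agreement with
  \<open>reduction_word\<close> is a matter of unfolding; \<open>hqsf_ints_eq\<close> supplies the
  algebraic meaning.\<close>

definition hqsf_ints :: "nat \<Rightarrow> rat mat list \<Rightarrow> nat \<Rightarrow> nat \<Rightarrow> nat \<Rightarrow> int" where
  "hqsf_ints m Qs k i j = signed (entry_at m (cleared_list (token_pairs (flat_entries m Qs))) k i j)"

definition hqsf_scale :: "nat \<Rightarrow> rat mat list \<Rightarrow> int" where
  "hqsf_scale m Qs = 2 ^ (8 * length (encode HQSF (m, Qs)))"

definition hqsf_to_tensor :: "nat \<times> rat mat list \<Rightarrow> nat \<times> (nat list \<Rightarrow> rat) \<times> rat" where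
  "hqsf_to_tensor = (\<lambda>(m, Qs).
    (m, \<lambda>is. of_int (reduction_tensor (hqsf_scale m Qs) (length Qs * (m * m)) (hqsf_ints m Qs) is),
     of_int (3 * hqsf_scale m Qs)))"

text \<open>The bridge between the two halves of the proof. The words agree letter by letter because
  all output numbers are integers, with denominator 1 and canonical digits.\<close>

lemma reduction_word_encode:
  "reduction_word (encode HQSF x) = encode (tensor_spectral_threshold 4) (hqsf_to_tensor x)"
proof -
  obtain m Qs where x: "x = (m, Qs)" by (cases x)
  have val: "val (replicate n False @ [True]) = 2 ^ n" "val (replicate n False @ [True, True]) = 3 * 2 ^ n" for n
    by (induction n) auto
  have ints: "(\<lambda>k i j. signed (entry_at m (cleared_list (token_pairs (flat_entries m Qs))) k i j)) = hqsf_ints m Qs"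
    by (simp add: fun_eq_iff hqsf_ints_def)
  have len: "length (cleared_list (token_pairs (flat_entries m Qs))) = length Qs * (m * m)"
    by (simp add: cleared_list_def length_flat_entries)
  show ?thesis
    unfolding x reduction_word_def toks_encode all_entries_eq write_rat_eq split_sum_correct signed_summands
    by (simp add: pairs_concat val len tensor_spectral_threshold_def hqsf_to_tensor_def enc_dim_def
        hqsf_scale_def ints)
qed

lemma hqsf_ints_eq:
  assumes "k < length Qs" "i < m" "j < m"
  shows "real_of_int (hqsf_ints m Qs k i j) =
    real_of_int (common_denominator (flat_entries m Qs)) * of_rat (Qs ! k $$ (i, j))"
proof -
  have "i * m + j < m * m"
    using assms(2,3) by (metis add.commute less_le_trans mult_Suc mult_le_mono1 nat_add_left_cancel_less Suc_leI)
  moreover have "Suc k * (m * m) \<le> length Qs * (m * m)"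
    using assms(1) by (intro mult_le_mono1) simp
  ultimately have p: "k * m * m + i * m + j < length (flat_entries m Qs)"
    by (simp add: length_flat_entries mult.assoc)
  then show ?thesis
    using signed_cleared[OF p] nth_flat_entries[OF assms]
    by (simp add: hqsf_ints_def entry_at_def lookup_eq cleared_list_def)
qed

lemma hqsf_ints_eq_0:
  assumes "length Qs \<le> k" shows "hqsf_ints m Qs k i j = 0"
proof -
  have "length Qs * (m * m) \<le> k * m * m + i * m + j"
    unfolding mult.assoc[of k] by (intro trans_le_add1 mult_le_mono1 assms)
  then show ?thesis
    by (simp add: hqsf_ints_def entry_at_def lookup_eq cleared_list_def length_flat_entries signed_def)
qed

lemma abs_hqsf_ints_le: "\<bar>hqsf_ints m Qs k i j\<bar> \<le> 2 ^ length (encode HQSF (m, Qs))"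
proof -
  have "\<bar>signed (cleared (token_pairs (flat_entries m Qs)) p)\<bar> \<le> 2 ^ length (encode HQSF (m, Qs))" for p
    using abs_signed_cleared_le[of "flat_entries m Qs" p]
    by (rule order_trans) (unfold length_encode_HQSF, rule power_increasing, auto)
  then show ?thesis
    by (auto simp: hqsf_ints_def entry_at_def lookup_eq cleared_list_def signed_def[of "(False, [])"])
qed

lemma qform_eq_scalar_prod:
  assumes "z \<in> carrier_vec m" "Q \<in> carrier_mat m m"
  shows "z \<bullet> (map_mat of_rat Q *\<^sub>v z) = qform m (\<lambda>i j. of_rat (Q $$ (i, j))) (\<lambda>i. z $ i)"
  using assms
  by (auto simp: scalar_prod_def qform_def mult_mat_vec_def atLeast0LessThan sum_distrib_left mult_ac
      intro!: sum.cong)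

lemma hqsf_scale_bound:
  assumes "(\<Sum>i<m. (x i)\<^sup>2) = 1"
  shows "(\<Sum>k<length Qs * (m * m). (qform m (\<lambda>i j. real_of_int (hqsf_ints m Qs k i j)) x)\<^sup>2)
    \<le> real_of_int (hqsf_scale m Qs)"
proof -
  define L where "L = length (encode HQSF (m, Qs))"
  let ?R = "length Qs * (m * m)"
  have "length qs \<le> sum_list (map (\<lambda>q. length (num_token q) + length (den_token q) + 2) qs)" for qs
    by (induction qs) auto
  from this[of "flat_entries m Qs"] have RL: "?R \<le> L" "m \<le> L"
    by (auto simp: L_def length_encode_HQSF length_flat_entries)
  have pow: "real n \<le> 2 ^ L" if "n \<le> L" for n
    using that of_nat_less_two_power[of L, where 'a = real] by linarith
  have bound: "\<bar>real_of_int (hqsf_ints m Qs k i j)\<bar> \<le> 2 ^ L" for k i j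
  proof -
    have "real_of_int \<bar>hqsf_ints m Qs k i j\<bar> \<le> real_of_int (2 ^ L)"
      using abs_hqsf_ints_le[of m Qs k i j] unfolding L_def of_int_le_iff .
    then show ?thesis by simp
  qed
  have "(\<Sum>k<?R. (qform m (\<lambda>i j. real_of_int (hqsf_ints m Qs k i j)) x)\<^sup>2) \<le> real ?R * (real m * real m * 2 ^ L)\<^sup>2"
    by (rule sum_qform_squares_le) (use assms bound in auto)
  \<comment> \<open>The number of forms and the dimension are at most \<open>L\<close>, hence at
    most \<open>2 ^ L\<close>, like the entries. This gives exponent \<open>1 + 2 * 3 = 7\<close>
    times \<open>L\<close>; the eighth is slack.\<close>
  also have "\<dots> \<le> 2 ^ L * (2 ^ L * 2 ^ L * 2 ^ L)\<^sup>2"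
    by (intro mult_mono power_mono pow RL) auto
  also have "\<dots> = 2 ^ (7 * L)"
    by (simp flip: power_add power_mult)
  also have "\<dots> \<le> 2 ^ (8 * L)"
    by (rule power_increasing) auto
  finally show ?thesis by (simp add: hqsf_scale_def L_def)
qed

lemma hqsf_to_tensor_reduction: "many_one_reduction HQSF (tensor_spectral_threshold 4) hqsf_to_tensor"
  unfolding many_one_reduction_def
proof (intro conjI ballI funcsetI)
  fix x assume x_inst: "x \<in> instances HQSF"
  obtain m Qs where x: "x = (m, Qs)" by (cases x)
  have m: "m \<ge> 1" and Qs: "\<And>k. k < length Qs \<Longrightarrow> Qs ! k \<in> carrier_mat m m \<and> transpose_mat (Qs ! k) = Qs ! k"
    using x_inst by (auto simp: x HQSF_def)
  define R where "R = length Qs * (m * m)"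
  define D where "D = real_of_int (common_denominator (flat_entries m Qs))"
  define E where "E k i j = real_of_int (hqsf_ints m Qs k i j)" for k i j
  have E_eq: "E = (\<lambda>k i j. real_of_int (hqsf_ints m Qs k i j))"
    by (simp add: fun_eq_iff E_def)
  define K where "K = real_of_int (hqsf_scale m Qs)"
  have D: "D > 0" by (simp add: D_def common_denominator_pos)
  \<comment> \<open>Since \<open>m \<ge> 1\<close>, the range below \<open>R\<close> includes all
    matrices.\<close>
  have "length Qs * 1 \<le> R" unfolding R_def using m by (intro mult_le_mono2) simp
  then have R: "length Qs \<le> R" by simp
  have sym: "hqsf_ints m Qs k i j = hqsf_ints m Qs k j i" if "i < m" "j < m" for k i j
  proof (cases "k < length Qs")
    case True
    then have "Qs ! k $$ (i, j) = Qs ! k $$ (j, i)"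
      using Qs[OF True] that by (metis carrier_matD index_transpose_mat(1))
    then have "real_of_int (hqsf_ints m Qs k i j) = real_of_int (hqsf_ints m Qs k j i)"
      using True that by (simp add: hqsf_ints_eq)
    then show ?thesis by simp
  qed (simp add: hqsf_ints_eq_0)
  have "symmetric_tensor 4 m (reduction_tensor (hqsf_scale m Qs) R (hqsf_ints m Qs))"
    by (rule symmetric_reduction_tensor) (use sym in blast)
  then have "symmetric_tensor 4 m (\<lambda>is. rat_of_int (reduction_tensor (hqsf_scale m Qs) R (hqsf_ints m Qs) is))"
    unfolding symmetric_tensor_def by (intro ballI impI arg_cong[where f = rat_of_int]) blast
  then show "hqsf_to_tensor x \<in> instances (tensor_spectral_threshold 4)"
    using m by (simp add: x hqsf_to_tensor_def tensor_spectral_threshold_def flip: R_def)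
  have qform: "qform m (E k) (\<lambda>i. z $ i) = D * (z \<bullet> (map_mat of_rat (Qs ! k) *\<^sub>v z))"
    if "k < length Qs" "z \<in> carrier_vec m" for k z
    using that Qs[OF that(1)] unfolding qform_eq_scalar_prod[OF that(2) conjunct1[OF Qs[OF that(1)]]]
    by (simp add: qform_def E_def hqsf_ints_eq sum_distrib_left mult.assoc flip: D_def)
  have qform_0: "qform m (E k) z = 0" if "length Qs \<le> k" for k z
    using that by (simp add: qform_def E_def hqsf_ints_eq_0)
  have "yes (tensor_spectral_threshold 4) (hqsf_to_tensor x) \<longleftrightarrow>
      sym_op_norm 4 m (reduction_tensor K R E) \<ge> 3 * K"
  proof -
    have "(\<lambda>is. of_rat (of_int (reduction_tensor (hqsf_scale m Qs) R (hqsf_ints m Qs) is))) = reduction_tensor K R E"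
      by (simp only: of_rat_of_int_eq) (simp only: of_int_reduction_tensor K_def E_eq)
    then show ?thesis
      by (simp add: x hqsf_to_tensor_def tensor_spectral_threshold_def K_def of_rat_mult flip: R_def)
  qed
  also have "\<dots> \<longleftrightarrow> (\<exists>z \<in> carrier_vec m. vnorm z = 1 \<and> (\<forall>k<R. qform m (E k) (\<lambda>i. z $ i) = 0))"
    by (rule sym_op_norm_reduction_tensor[OF m]) (simp only: K_def E_eq R_def hqsf_scale_bound)
  also have "\<dots> \<longleftrightarrow> (\<exists>z \<in> carrier_vec m. (vnorm z)\<^sup>2 = 1 \<and> (\<forall>Q \<in> set Qs. z \<bullet> (map_mat of_rat Q *\<^sub>v z) = 0))"
  proof (intro bex_cong refl conj_cong)
    fix z :: "real vec" assume z: "z \<in> carrier_vec m"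
    have "vnorm z \<ge> 0" by (simp add: vnorm_def scalar_prod_def sum_nonneg)
    then show "vnorm z = 1 \<longleftrightarrow> (vnorm z)\<^sup>2 = 1" by (auto simp: power2_eq_1_iff)
    \<comment> \<open>The indices from \<open>length Qs\<close> up to \<open>R\<close> belong to
      zero forms and impose no condition.\<close>
    have "(\<forall>k<R. qform m (E k) (\<lambda>i. z $ i) = 0) \<longleftrightarrow> (\<forall>k<length Qs. qform m (E k) (\<lambda>i. z $ i) = 0)"
      using R qform_0 by (meson less_le_trans not_less)
    also have "\<dots> \<longleftrightarrow> (\<forall>k<length Qs. z \<bullet> (map_mat of_rat (Qs ! k) *\<^sub>v z) = 0)"
      using qform z D by simp
    finally show "(\<forall>k<R. qform m (E k) (\<lambda>i. z $ i) = 0) \<longleftrightarrow> (\<forall>Q \<in> set Qs. z \<bullet> (map_mat of_rat Q *\<^sub>v z) = 0)"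
      by (simp add: all_set_conv_all_nth)
  qed
  also have "\<dots> \<longleftrightarrow> yes HQSF x"
    by (simp add: x HQSF_def)
  finally show "yes HQSF x \<longleftrightarrow> yes (tensor_spectral_threshold 4) (hqsf_to_tensor x)" by simp
qed

theorem mainTheorem4:
  shows "poly_time_many_one_reducible HQSF (tensor_spectral_threshold 4)"
proof -
  obtain M p where "wf_tm M" and M: "\<And>w. computes_within M (poly p (length w)) w (reduction_word w)"
    by (rule ptime_turing_machine[OF ptime_reduction_word]) blast
  \<comment> \<open>The machine computes \<open>reduction_word\<close> on every word; on an encoding
    its output is the encoding of the image instance.\<close>
  then have "poly_time_map HQSF (tensor_spectral_threshold 4) hqsf_to_tensor"
    unfolding poly_time_map_def using M[of "encode HQSF x" for x, unfolded reduction_word_encode] by blast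
  then show ?thesis
    unfolding poly_time_many_one_reducible_def using hqsf_to_tensor_reduction by blast
qed

end
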